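(* For every $n\ge0$ and every equivariant idempotent $(e,\sigma)$ of size $N$, the element $\mathrm{ch}^n(e,\sigma):=\mathrm{Tr}_\sigma(e^{\otimes(n+1)})\in C^{\mathcal{U}}_n(\mathcal{A})$ is a cycle in the complex $\big(C^{\mathcal{U}}_\bullet(\mathcal{A})/\mathrm{Im}(1-\lambda_\bullet),\,b_\bullet\big)$, and its homology class in $HC^{\mathcal{U}}_n(\mathcal{A})$ depends only on the isomorphism class of the equivariant projective module $\mathcal{A}^Ne$; consequently $\mathrm{ch}^n$ induces a well-defined group homomorphism $K_0^{\mathcal{U}}(\mathcal{A})\to HC^{\mathcal{U}}_n(\mathcal{A})$.
   Context: $\mathcal{U}$ is a Hopf algebra with coproduct $h\mapsto h_{(1)}\otimes h_{(2)}$ and $\mathcal{A}$ a unital left $\mathcal{U}$-module algebra (action $\triangleright$). An equivariant idempotent $(e,\sigma)$ of size $N$: $e\in\mathrm{Mat}_N(\mathcal{A})$, $e^2=e$, $\sigma:\mathcal{U}\to\mathrm{Mat}_N(\mathbb{C})$ a representation with $(h_{(1)}\triangleright e)\sigma(h_{(2)})^t=\sigma(h)^te$; its module $\mathcal{A}^Ne$ is a left $\mathcal{A}\rtimes\mathcal{U}$-module via $(a.w)_i=aw_i$, $(h.w)_i=\sum_j(h_{(1)}\triangleright w_j)\sigma_{ij}(h_{(2)})$. $K_0^{\mathcal{U}}(\mathcal{A})$ is the Grothendieck group of isomorphism classes of such modules under direct sum. $\mathcal{U}$ acts on $\mathcal{A}^{\otimes(n+1)}$ by $h\blacktriangleright(a_0\otimes\cdots\otimes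 a_n)=h_{(1)}\triangleright a_0\otimes\cdots\otimes h_{(n+1)}\triangleright a_n$. $C^{\mathcal{U}}_n(\mathcal{A})$ is the space of linear maps $\omega:\mathcal{U}\to\mathcal{A}^{\otimes(n+1)}$ with $(h_{(1)}\blacktriangleright\omega)(xh_{(2)})=\omega(hx)$ for all $h,x$. Face maps: $b_{n,i}(a_0\otimes\cdots\otimes a_n)(h)=(a_0\otimes\cdots\otimes a_ia_{i+1}\otimes\cdots\otimes a_n)(h)$ for $i<n$ (maps evaluated pointwise, i.e. applied to the tensor part of $\omega(h)$), $b_{n,n}(a_0\otimes\cdots\otimes a_n)(h)=\big((h_{(1)}\triangleright a_n)a_0\otimes a_1\otimes\cdots\otimes a_{n-1}\big)(h_{(2)})$; cyclic operator $\lambda_n(a_0\otimes\cdots\otimes a_n)(h)=(-1)^n\big((h_{(1)}\triangleright a_n)\otimes a_0\otimes\cdots\otimes a_{n-1}\big)(h_{(2)})$; $b_n=\sum_{i=0}^n(-1)^ib_{n,i}$. (Here an expression $(\alpha)(h_{(2)})$ for $\omega$ means: write $\omega(h_{(2)})$ as a sum of elementary tensors $a_0\otimes\cdots\otimes a_n$ and apply the displayed formula with $h_{(1)}$.) $HC^{\mathcal{U}}_n(\mathcal{A})$ is the $n$-th homology of $(C^{\mathcal{U}}_\bullet(\mathcal{A})/\mathrm{Im}(1-\lambda_\bullet),b_\bullet)$. For $T_0,\ldots,T_n\in\mathrm{Mat}_N(\mathcal{A})$, $\mathrm{Tr}_\sigma(T_0\otimes\cdots\otimes T_n)(h):=\sum_{i_0,\ldots,i_{n+1}}(T_0)_{i_0i_1}\otimes(T_1)_{i_1i_2}\otimes\cdots\otimes(T_n)_{i_ni_{n+1}}\,\sigma(h)_{i_0i_{n+1}}$.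 *)

theory Defs
  imports Main "HOL.Complex"
begin

text \<open>A unital complex algebra is a ring X together with a unital ring homomorphism
  ofX from the complex numbers into the centre of X; scalar multiplication is
  c.x = ofX c * x.\<close>

definition cplx_alg :: "(complex \<Rightarrow> 'x::ring_1) \<Rightarrow> bool" where
  "cplx_alg ofX \<longleftrightarrow> ofX 1 = 1 \<and> (\<forall>c d. ofX (c + d) = ofX c + ofX d)
     \<and> (\<forall>c d. ofX (c * d) = ofX c * ofX d) \<and> (\<forall>c x. ofX c * x = x * ofX c)"

text \<open>An element of the k-th tensor power of X is represented by a finite formal linear
  combination of elementary tensors x1 (x) ... (x) xk, i.e. a list of pairs (coefficient,
  list of length k). Two such representatives denote the same tensor iff every
  k-multilinear functional X^k -> C takes the same value on them (over a field the
  multilinear functionals, i.e. the dual of the tensor power, separate points).\<close>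

type_synonym 'x ten = "(complex \<times> 'x list) list"

definition wf_ten :: "nat \<Rightarrow> 'x ten \<Rightarrow> bool" where
  "wf_ten k t \<longleftrightarrow> (\<forall>(c, xs) \<in> set t. length xs = k)"

definition multilin :: "(complex \<Rightarrow> 'x::ring_1) \<Rightarrow> nat \<Rightarrow> ('x list \<Rightarrow> complex) \<Rightarrow> bool" where
  "multilin ofX k \<phi> \<longleftrightarrow>
     (\<forall>xs i a b c. length xs = k \<longrightarrow> i < k \<longrightarrow>
        \<phi> (xs[i := a + b]) = \<phi> (xs[i := a]) + \<phi> (xs[i := b]) \<and>
        \<phi> (xs[i := ofX c * a]) = c * \<phi> (xs[i := a]))"

definition tev :: "('x list \<Rightarrow> complex) \<Rightarrow> 'x ten \<Rightarrow> complex" where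
  "tev \<phi> t = sum_list (map (\<lambda>(c, xs). c * \<phi> xs) t)"

definition teq :: "(complex \<Rightarrow> 'x::ring_1) \<Rightarrow> nat \<Rightarrow> 'x ten \<Rightarrow> 'x ten \<Rightarrow> bool" where
  "teq ofX k t s \<longleftrightarrow> (\<forall>\<phi>. multilin ofX k \<phi> \<longrightarrow> tev \<phi> t = tev \<phi> s)"

definition tscale :: "complex \<Rightarrow> 'x ten \<Rightarrow> 'x ten" where
  "tscale c t = map (\<lambda>(d, xs). (c * d, xs)) t"

definition tbind :: "'x ten \<Rightarrow> ('x list \<Rightarrow> 'y ten) \<Rightarrow> 'y ten" where
  "tbind t f = concat (map (\<lambda>(c, xs). tscale c (f xs)) t)"

definition hopf_algebra ::
  "(complex \<Rightarrow> 'u::ring_1) \<Rightarrow> ('u \<Rightarrow> 'u ten) \<Rightarrow> ('u \<Rightarrow> complex) \<Rightarrow> ('u \<Rightarrow> 'u) \<Rightarrow> bool" where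
  "hopf_algebra ofU cop eps S \<longleftrightarrow>
     cplx_alg ofU \<and>
     \<comment> \<open>coproduct: linear algebra map U -> U (x) U\<close>
     (\<forall>h. wf_ten 2 (cop h)) \<and>
     (\<forall>g h. teq ofU 2 (cop (g + h)) (cop g @ cop h)) \<and>
     (\<forall>c h. teq ofU 2 (cop (ofU c * h)) (tscale c (cop h))) \<and>
     teq ofU 2 (cop 1) [(1, [1, 1])] \<and>
     (\<forall>g h. teq ofU 2 (cop (g * h))
        (tbind (cop g) (\<lambda>xs. tbind (cop h) (\<lambda>ys. [(1, [xs!0 * ys!0, xs!1 * ys!1])])))) \<and>
     \<comment> \<open>coassociativity\<close>
     (\<forall>h. teq ofU 3
        (tbind (cop h) (\<lambda>xs. tbind (cop (xs!0)) (\<lambda>ys. [(1, [ys!0, ys!1, xs!1])])))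
        (tbind (cop h) (\<lambda>xs. tbind (cop (xs!1)) (\<lambda>ys. [(1, [xs!0, ys!0, ys!1])])))) \<and>
     \<comment> \<open>counit: linear algebra map U -> C\<close>
     (\<forall>g h. eps (g + h) = eps g + eps h) \<and> (\<forall>c h. eps (ofU c * h) = c * eps h) \<and>
     (\<forall>g h. eps (g * h) = eps g * eps h) \<and> eps 1 = 1 \<and>
     (\<forall>h. sum_list (map (\<lambda>(c, xs). ofU (c * eps (xs!0)) * xs!1) (cop h)) = h) \<and>
     (\<forall>h. sum_list (map (\<lambda>(c, xs). ofU (c * eps (xs!1)) * xs!0) (cop h)) = h) \<and>
     \<comment> \<open>antipode\<close>
     (\<forall>g h. S (g + h) = S g + S h) \<and> (\<forall>c h. S (ofU c * h) = ofU c * S h) \<and>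
     (\<forall>h. sum_list (map (\<lambda>(c, xs). ofU c * (S (xs!0) * xs!1)) (cop h)) = ofU (eps h)) \<and>
     (\<forall>h. sum_list (map (\<lambda>(c, xs). ofU c * (xs!0 * S (xs!1))) (cop h)) = ofU (eps h))"

definition module_algebra ::
  "(complex \<Rightarrow> 'u::ring_1) \<Rightarrow> ('u \<Rightarrow> 'u ten) \<Rightarrow> ('u \<Rightarrow> complex) \<Rightarrow>
   (complex \<Rightarrow> 'a::ring_1) \<Rightarrow> ('u \<Rightarrow> 'a \<Rightarrow> 'a) \<Rightarrow> bool" where
  "module_algebra ofU cop eps ofA act \<longleftrightarrow>
     cplx_alg ofA \<and>
     (\<forall>g h a. act (g + h) a = act g a + act h a) \<and>
     (\<forall>c h a. act (ofU c * h) a = ofA c * act h a) \<and>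
     (\<forall>h a b. act h (a + b) = act h a + act h b) \<and>
     (\<forall>c h a. act h (ofA c * a) = ofA c * act h a) \<and>
     (\<forall>g h a. act (g * h) a = act g (act h a)) \<and>
     (\<forall>a. act 1 a = a) \<and>
     (\<forall>h a b. act h (a * b) =
        sum_list (map (\<lambda>(c, xs). ofA c * (act (xs!0) a * act (xs!1) b)) (cop h))) \<and>
     (\<forall>h. act h 1 = ofA (eps h))"

text \<open>copn n h = h(1) (x) ... (x) h(n+1) in the (n+1)-st tensor power of U.\<close>
primrec copn :: "('u \<Rightarrow> 'u ten) \<Rightarrow> nat \<Rightarrow> 'u \<Rightarrow> 'u ten" where
  "copn cop 0 h = [(1, [h])]"
| "copn cop (Suc n) h =
     tbind (copn cop n h) (\<lambda>xs. tbind (cop (last xs)) (\<lambda>ys. [(1, butlast xs @ ys)]))"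

definition tact :: "('u \<Rightarrow> 'u ten) \<Rightarrow> ('u \<Rightarrow> 'a \<Rightarrow> 'a) \<Rightarrow> nat \<Rightarrow> 'u \<Rightarrow> 'a ten \<Rightarrow> 'a ten" where
  "tact cop act n h t = tbind (copn cop n h) (\<lambda>hs. tbind t (\<lambda>as. [(1, map2 act hs as)]))"

type_synonym ('u, 'a) cochain = "'u \<Rightarrow> 'a ten"

definition ceq :: "(complex \<Rightarrow> 'a::ring_1) \<Rightarrow> nat \<Rightarrow> ('u, 'a) cochain \<Rightarrow> ('u, 'a) cochain \<Rightarrow> bool" where
  "ceq ofA n \<omega> \<eta> \<longleftrightarrow> (\<forall>h. teq ofA (Suc n) (\<omega> h) (\<eta> h))"

definition cadd :: "('u, 'a) cochain \<Rightarrow> ('u, 'a) cochain \<Rightarrow> ('u, 'a) cochain" where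
  "cadd \<omega> \<eta> = (\<lambda>h. \<omega> h @ \<eta> h)"

definition csub :: "('u, 'a) cochain \<Rightarrow> ('u, 'a) cochain \<Rightarrow> ('u, 'a) cochain" where
  "csub \<omega> \<eta> = (\<lambda>h. \<omega> h @ tscale (-1) (\<eta> h))"

definition chain ::
  "(complex \<Rightarrow> 'u::ring_1) \<Rightarrow> ('u \<Rightarrow> 'u ten) \<Rightarrow> (complex \<Rightarrow> 'a::ring_1) \<Rightarrow> ('u \<Rightarrow> 'a \<Rightarrow> 'a) \<Rightarrow>
   nat \<Rightarrow> ('u, 'a) cochain \<Rightarrow> bool" where
  "chain ofU cop ofA act n \<omega> \<longleftrightarrow>
     (\<forall>h. wf_ten (Suc n) (\<omega> h)) \<and>
     (\<forall>g h. teq ofA (Suc n) (\<omega> (g + h)) (\<omega> g @ \<omega> h)) \<and>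
     (\<forall>c h. teq ofA (Suc n) (\<omega> (ofU c * h)) (tscale c (\<omega> h))) \<and>
     (\<forall>h x. teq ofA (Suc n)
        (tbind (cop h) (\<lambda>ys. tact cop act n (ys!0) (\<omega> (x * ys!1)))) (\<omega> (h * x)))"

definition merge_at :: "nat \<Rightarrow> 'a::times list \<Rightarrow> 'a list" where
  "merge_at i as = take i as @ [as!i * as!(Suc i)] @ drop (Suc (Suc i)) as"

definition face :: "('u \<Rightarrow> 'u ten) \<Rightarrow> ('u \<Rightarrow> 'a::ring_1 \<Rightarrow> 'a) \<Rightarrow> nat \<Rightarrow> nat \<Rightarrow>
    ('u, 'a) cochain \<Rightarrow> ('u, 'a) cochain" where
  "face cop act n i \<omega> = (\<lambda>h.
     if i < n then tbind (\<omega> h) (\<lambda>as. [(1, merge_at i as)])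
     else tbind (cop h) (\<lambda>ys. tbind (\<omega> (ys!1))
            (\<lambda>as. [(1, (act (ys!0) (last as) * hd as) # butlast (tl as))])))"

definition bnd :: "('u \<Rightarrow> 'u ten) \<Rightarrow> ('u \<Rightarrow> 'a::ring_1 \<Rightarrow> 'a) \<Rightarrow> nat \<Rightarrow>
    ('u, 'a) cochain \<Rightarrow> ('u, 'a) cochain" where
  "bnd cop act n \<omega> = (\<lambda>h. concat (map (\<lambda>i. tscale ((-1) ^ i) (face cop act n i \<omega> h)) [0..<Suc n]))"

definition lam :: "('u \<Rightarrow> 'u ten) \<Rightarrow> ('u \<Rightarrow> 'a \<Rightarrow> 'a) \<Rightarrow> nat \<Rightarrow>
    ('u, 'a) cochain \<Rightarrow> ('u, 'a) cochain" where
  "lam cop act n \<omega> = (\<lambda>h. tscale ((-1) ^ n)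
     (tbind (cop h) (\<lambda>ys. tbind (\<omega> (ys!1)) (\<lambda>as. [(1, act (ys!0) (last as) # butlast as)]))))"

definition in_im_lam ::
  "(complex \<Rightarrow> 'u::ring_1) \<Rightarrow> ('u \<Rightarrow> 'u ten) \<Rightarrow> (complex \<Rightarrow> 'a::ring_1) \<Rightarrow> ('u \<Rightarrow> 'a \<Rightarrow> 'a) \<Rightarrow>
   nat \<Rightarrow> ('u, 'a) cochain \<Rightarrow> bool" where
  "in_im_lam ofU cop ofA act n \<theta> \<longleftrightarrow>
     (\<exists>\<eta>. chain ofU cop ofA act n \<eta> \<and> ceq ofA n \<theta> (csub \<eta> (lam cop act n \<eta>)))"

text \<open>omega is a cycle of (C/Im(1-lambda), b) in degree n (b_0 = 0).\<close>
definition cyc_cycle ::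
  "(complex \<Rightarrow> 'u::ring_1) \<Rightarrow> ('u \<Rightarrow> 'u ten) \<Rightarrow> (complex \<Rightarrow> 'a::ring_1) \<Rightarrow> ('u \<Rightarrow> 'a \<Rightarrow> 'a) \<Rightarrow>
   nat \<Rightarrow> ('u, 'a) cochain \<Rightarrow> bool" where
  "cyc_cycle ofU cop ofA act n \<omega> \<longleftrightarrow>
     (case n of 0 \<Rightarrow> True | Suc m \<Rightarrow> in_im_lam ofU cop ofA act m (bnd cop act n \<omega>))"

definition cyc_homologous ::
  "(complex \<Rightarrow> 'u::ring_1) \<Rightarrow> ('u \<Rightarrow> 'u ten) \<Rightarrow> (complex \<Rightarrow> 'a::ring_1) \<Rightarrow> ('u \<Rightarrow> 'a \<Rightarrow> 'a) \<Rightarrow>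
   nat \<Rightarrow> ('u, 'a) cochain \<Rightarrow> ('u, 'a) cochain \<Rightarrow> bool" where
  "cyc_homologous ofU cop ofA act n \<omega> \<omega>' \<longleftrightarrow>
     (\<exists>\<eta> \<theta>. chain ofU cop ofA act (Suc n) \<eta> \<and> chain ofU cop ofA act n \<theta> \<and>
        ceq ofA n (csub \<omega> \<omega>') (cadd (bnd cop act (Suc n) \<eta>) (csub \<theta> (lam cop act n \<theta>))))"

text \<open>Matrices of size N are functions nat => nat => _, only entries with indices < N matter.\<close>

definition equiv_idem ::
  "(complex \<Rightarrow> 'u::ring_1) \<Rightarrow> ('u \<Rightarrow> 'u ten) \<Rightarrow> (complex \<Rightarrow> 'a::ring_1) \<Rightarrow> ('u \<Rightarrow> 'a \<Rightarrow> 'a) \<Rightarrow>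
   nat \<Rightarrow> (nat \<Rightarrow> nat \<Rightarrow> 'a) \<Rightarrow> ('u \<Rightarrow> nat \<Rightarrow> nat \<Rightarrow> complex) \<Rightarrow> bool" where
  "equiv_idem ofU cop ofA act N e \<sigma> \<longleftrightarrow>
     \<comment> \<open>e^2 = e\<close>
     (\<forall>i<N. \<forall>j<N. (\<Sum>k<N. e i k * e k j) = e i j) \<and>
     \<comment> \<open>sigma is a representation U -> Mat_N(C)\<close>
     (\<forall>g h. \<forall>i<N. \<forall>j<N. \<sigma> (g + h) i j = \<sigma> g i j + \<sigma> h i j) \<and>
     (\<forall>c h. \<forall>i<N. \<forall>j<N. \<sigma> (ofU c * h) i j = c * \<sigma> h i j) \<and>
     (\<forall>i<N. \<forall>j<N. \<sigma> 1 i j = (if i = j then 1 else 0)) \<and>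
     (\<forall>g h. \<forall>i<N. \<forall>j<N. \<sigma> (g * h) i j = (\<Sum>k<N. \<sigma> g i k * \<sigma> h k j)) \<and>
     \<comment> \<open>(h(1) |> e) sigma(h(2))^t = sigma(h)^t e\<close>
     (\<forall>h. \<forall>i<N. \<forall>j<N.
        sum_list (map (\<lambda>(c, ys). \<Sum>k<N. act (ys!0) (e i k) * ofA (c * \<sigma> (ys!1) j k)) (cop h))
        = (\<Sum>k<N. ofA (\<sigma> h k i) * e k j))"

text \<open>The module A^N e of row vectors w with w e = w.\<close>
definition pmod :: "nat \<Rightarrow> (nat \<Rightarrow> nat \<Rightarrow> 'a::ring_1) \<Rightarrow> (nat \<Rightarrow> 'a) set" where
  "pmod N e = {w. (\<forall>i\<ge>N. w i = 0) \<and> (\<forall>j<N. (\<Sum>i<N. w i * e i j) = w j)}"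

definition uact :: "('u \<Rightarrow> 'u ten) \<Rightarrow> (complex \<Rightarrow> 'a::ring_1) \<Rightarrow> ('u \<Rightarrow> 'a \<Rightarrow> 'a) \<Rightarrow>
   nat \<Rightarrow> ('u \<Rightarrow> nat \<Rightarrow> nat \<Rightarrow> complex) \<Rightarrow> 'u \<Rightarrow> (nat \<Rightarrow> 'a) \<Rightarrow> (nat \<Rightarrow> 'a)" where
  "uact cop ofA act N \<sigma> h w = (\<lambda>i. if i < N then
      sum_list (map (\<lambda>(c, ys). \<Sum>j<N. act (ys!0) (w j) * ofA (c * \<sigma> (ys!1) i j)) (cop h))
    else 0)"

text \<open>Isomorphism of the A rtimes U-modules A^N e and A^M f (A rtimes U is generated by
  A and U, so A-linearity plus U-equivariance is A rtimes U-linearity).\<close>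
definition mod_iso :: "('u \<Rightarrow> 'u ten) \<Rightarrow> (complex \<Rightarrow> 'a::ring_1) \<Rightarrow> ('u \<Rightarrow> 'a \<Rightarrow> 'a) \<Rightarrow>
   nat \<Rightarrow> (nat \<Rightarrow> nat \<Rightarrow> 'a) \<Rightarrow> ('u \<Rightarrow> nat \<Rightarrow> nat \<Rightarrow> complex) \<Rightarrow>
   nat \<Rightarrow> (nat \<Rightarrow> nat \<Rightarrow> 'a) \<Rightarrow> ('u \<Rightarrow> nat \<Rightarrow> nat \<Rightarrow> complex) \<Rightarrow> bool" where
  "mod_iso cop ofA act N e \<sigma> M f \<tau> \<longleftrightarrow>
     (\<exists>\<phi>. bij_betw \<phi> (pmod N e) (pmod M f) \<and>
        (\<forall>w\<in>pmod N e. \<forall>v\<in>pmod N e. \<phi> (\<lambda>i. w i + v i) = (\<lambda>i. \<phi> w i + \<phi> v i)) \<and>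
        (\<forall>a. \<forall>w\<in>pmod N e. \<phi> (\<lambda>i. a * w i) = (\<lambda>i. a * \<phi> w i)) \<and>
        (\<forall>h. \<forall>w\<in>pmod N e. \<phi> (uact cop ofA act N \<sigma> h w) = uact cop ofA act M \<tau> h (\<phi> w)))"

text \<open>Block sum (direct sum of equivariant idempotents): the module of the block sum is
  the direct sum of the modules.\<close>
definition bdiag :: "nat \<Rightarrow> (nat \<Rightarrow> nat \<Rightarrow> 'z::zero) \<Rightarrow> (nat \<Rightarrow> nat \<Rightarrow> 'z) \<Rightarrow> nat \<Rightarrow> nat \<Rightarrow> 'z" where
  "bdiag N X Y = (\<lambda>i j. if i < N \<and> j < N then X i j
                        else if N \<le> i \<and> N \<le> j then Y (i - N) (j - N) else 0)"

definition Tr_sigma :: "nat \<Rightarrow> ('u \<Rightarrow> nat \<Rightarrow> nat \<Rightarrow> complex) \<Rightarrow> (nat \<Rightarrow> nat \<Rightarrow> 'a) list \<Rightarrow> ('u, 'a) cochain" where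
  "Tr_sigma N \<sigma> Ts = (\<lambda>h. map (\<lambda>is. (\<sigma> h (is!0) (is!length Ts),
        map (\<lambda>k. (Ts!k) (is!k) (is!Suc k)) [0..<length Ts]))
     (List.n_lists (Suc (length Ts)) [0..<N]))"

definition chern :: "nat \<Rightarrow> nat \<Rightarrow> (nat \<Rightarrow> nat \<Rightarrow> 'a) \<Rightarrow> ('u \<Rightarrow> nat \<Rightarrow> nat \<Rightarrow> complex) \<Rightarrow> ('u, 'a) cochain" where
  "chern n N e \<sigma> = Tr_sigma N \<sigma> (replicate (Suc n) e)"

end

theory Submission
  imports Defs "HOL-Computational_Algebra.Polynomial"
begin

text \<open>The twisted trace of equivariant matrices intertwines faces and the cyclic operator with matrix
  multiplication and rotation, so \<open>b ch\<^sup>n\<close> is a multiple of \<open>ch\<^sup>n\<^sup>-\<^sup>1\<close>, and \<open>ch\<^sup>n = (1 - \<lambda>) (ch\<^sup>n / 2)\<close>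
  for odd \<open>n\<close>. For even \<open>n\<close>, an isomorphism is given by equivariant matrices \<open>u\<close>, \<open>v\<close> with \<open>u v = e\<close>,
  \<open>v u = f\<close>. In size \<open>N + M\<close> the block triangular idempotents \<open>E = (e u; 0 0)\<close> and \<open>F = (0 0; v f)\<close>
  have the same characters as \<open>e\<close> and \<open>f\<close>, and they satisfy \<open>E F = E\<close>, \<open>F E = F\<close>. Along the line
  \<open>p = E + t d\<close>, \<open>d = F - E\<close>, one has \<open>d p = d\<close> and \<open>p d = 0\<close>; hence \<open>d \<otimes> p\<^sup>\<otimes>\<^sup>n\<close> is the boundary of
  \<open>d \<otimes> p\<^sup>\<otimes>\<^sup>n\<^sup>+\<^sup>1\<close>, and the character is constant along the line.\<close>

section \<open>Tensors seen through multilinear functionals\<close>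

text \<open>Equality of tensors means equality under all multilinear functionals, so an identity
  between coproduct sums can be used only after a functional has been applied. Hence chains are
  evaluated by \<open>tev\<close>, and the trace becomes a sum over index paths. Parity enters
  through the boundary of d \<otimes> p^(n+1): its inner faces all agree, with total coefficient the
  sum of (-1)^i over i = 0, ..., n. This is 1 for even n and 0 for odd n, so the homotopy argument
  works exactly in the degrees where the sign of \<lambda> does not already kill the character. E
  and F arise as follows: acting on row vectors from the right, both project A^(N+M) onto the graph
  of the isomorphism w \<mapsto> w u, along different complements. Projections onto a fixed
  submodule form an affine space, and equivariance is a linear condition, so a straight line stays
  inside the equivariant idempotents. Being null-homologous is an existence statement and cannot be
  integrated over t. But the character of p is polynomial in t of degree at most n + 1, so n + 1
  values of its derivative determine the difference of the end values.\<close>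

definition clin :: "(complex \<Rightarrow> 'x::ring_1) \<Rightarrow> ('x \<Rightarrow> complex) \<Rightarrow> bool" where
  "clin ofX L \<longleftrightarrow> (\<forall>a b. L (a + b) = L a + L b) \<and> (\<forall>c a. L (ofX c * a) = c * L a)"

lemma clin_0: "clin ofX L \<Longrightarrow> L 0 = 0"
  unfolding clin_def by (metis add_cancel_right_right)

lemma clin_sum: "clin ofX L \<Longrightarrow> L (\<Sum>i\<in>I. f i) = (\<Sum>i\<in>I. L (f i))"
  by (induction I rule: infinite_finite_induct) (auto simp: clin_0, auto simp: clin_def)

lemma clin_sum_list: "clin ofX L \<Longrightarrow> L (sum_list xs) = sum_list (map L xs)"
  by (induction xs) (auto simp: clin_0, auto simp: clin_def)

lemma clin_plus: "clin ofX f \<Longrightarrow> clin ofX g \<Longrightarrow> clin ofX (\<lambda>a. f a + g a)"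
  by (auto simp: clin_def algebra_simps)

lemma clin_scale: "clin ofX f \<Longrightarrow> clin ofX (\<lambda>a. c * f a)"
  by (auto simp: clin_def algebra_simps)

lemma clin_scale_right: "clin ofX f \<Longrightarrow> clin ofX (\<lambda>a. f a * c)"
  by (auto simp: clin_def algebra_simps)

lemma clin_const_0: "clin ofX (\<lambda>a. 0)"
  by (auto simp: clin_def)

lemma clin_Sum: "(\<And>i. i \<in> I \<Longrightarrow> clin ofX (f i)) \<Longrightarrow> clin ofX (\<lambda>a. \<Sum>i\<in>I. f i a)"
  by (induction I rule: infinite_finite_induct) (auto intro: clin_plus clin_const_0)

lemma multilin_clin:
  "multilin ofX k \<phi> \<longleftrightarrow> (\<forall>xs i. length xs = k \<longrightarrow> i < k \<longrightarrow> clin ofX (\<lambda>a. \<phi> (xs[i := a])))"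
  unfolding multilin_def clin_def by blast

lemma multilin_0 [simp]: "multilin ofX 0 \<phi>"
  by (simp add: multilin_def)

text \<open>Peeling off the first slot replaces list updates by consing, the form used in the
  inductions below.\<close>

lemma multilin_Suc:
  "multilin ofX (Suc k) \<phi> \<longleftrightarrow>
     (\<forall>xs. length xs = k \<longrightarrow> clin ofX (\<lambda>a. \<phi> (a # xs))) \<and> (\<forall>a. multilin ofX k (\<lambda>xs. \<phi> (a # xs)))"
  (is "?l \<longleftrightarrow> ?r")
proof
  assume l: ?l
  show ?r
  proof (intro conjI allI impI)
    fix xs :: "'a list" assume "length xs = k"
    then show "clin ofX (\<lambda>a. \<phi> (a # xs))"
      using l[unfolded multilin_clin, rule_format, of "0 # xs" 0] by simp
  next
    fix a show "multilin ofX k (\<lambda>xs. \<phi> (a # xs))"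
      unfolding multilin_clin
    proof (intro allI impI)
      fix xs :: "'a list" and i assume "length xs = k" "i < k"
      then show "clin ofX (\<lambda>b. \<phi> (a # xs[i := b]))"
        using l[unfolded multilin_clin, rule_format, of "a # xs" "Suc i"] by simp
    qed
  qed
next
  assume r: ?r
  show ?l unfolding multilin_clin
  proof (intro allI impI)
    fix xs :: "'a list" and i assume *: "length xs = Suc k" "i < Suc k"
    then obtain a ys where xs: "xs = a # ys" "length ys = k" by (cases xs) auto
    show "clin ofX (\<lambda>a. \<phi> (xs[i := a]))"
      using r * xs by (cases i) (auto simp: multilin_clin)
  qed
qed

lemma multilin_Cons: "multilin ofX (Suc k) \<phi> \<Longrightarrow> multilin ofX k (\<lambda>xs. \<phi> (a # xs))"
  by (simp add: multilin_Suc)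

lemma multilin_hd: "multilin ofX (Suc k) \<phi> \<Longrightarrow> length xs = k \<Longrightarrow> clin ofX (\<lambda>a. \<phi> (a # xs))"
  by (simp add: multilin_Suc)

lemma multilin_snoc: "multilin ofX (Suc k) \<phi> \<Longrightarrow> multilin ofX k (\<lambda>xs. \<phi> (xs @ [y]))"
proof (induction k arbitrary: \<phi>)
  case (Suc k)
  show ?case
    unfolding multilin_Suc[where k = k]
    using Suc.IH[OF multilin_Cons[OF Suc.prems]] multilin_hd[OF Suc.prems] by simp
qed simp

lemma multilin_last: "multilin ofX (Suc k) \<phi> \<Longrightarrow> length xs = k \<Longrightarrow> clin ofX (\<lambda>y. \<phi> (xs @ [y]))"
proof (induction k arbitrary: \<phi> xs)
  case 0
  then show ?case by (simp add: multilin_Suc)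
next
  case (Suc k)
  then show ?case by (cases xs) (auto dest: multilin_Cons)
qed

lemma multilin_2:
  assumes "\<And>b. clin ofX (\<lambda>a. B a b)" "\<And>a. clin ofX (B a)"
  shows "multilin ofX 2 (\<lambda>xs. B (xs ! 0) (xs ! 1))"
  using assms by (auto simp: numeral_2_eq_2 multilin_Suc)

lemma multilin_3:
  assumes "\<And>b c. clin ofX (\<lambda>a. B a b c)" "\<And>a c. clin ofX (\<lambda>b. B a b c)" "\<And>a b. clin ofX (B a b)"
  shows "multilin ofX 3 (\<lambda>xs. B (xs ! 0) (xs ! 1) (xs ! 2))"
  using assms by (auto simp: numeral_3_eq_3 multilin_Suc eval_nat_numeral length_Suc_conv)

lemma tev_Nil [simp]: "tev \<phi> [] = 0"
  and tev_Cons: "tev \<phi> ((c, xs) # t) = c * \<phi> xs + tev \<phi> t"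
  and tev_single [simp]: "tev \<phi> [(1, xs)] = \<phi> xs"
  and tev_append [simp]: "tev \<phi> (t @ s) = tev \<phi> t + tev \<phi> s"
  by (auto simp: tev_def)

lemma tev_tscale [simp]: "tev \<phi> (tscale c t) = c * tev \<phi> t"
  by (induction t) (auto simp: tscale_def tev_def algebra_simps)

lemma tev_tbind [simp]: "tev \<phi> (tbind t f) = tev (\<lambda>xs. tev \<phi> (f xs)) t"
proof (induction t)
  case (Cons a t)
  then show ?case by (cases a) (simp add: tbind_def tev_Cons)
qed (simp add: tbind_def)

lemma tev_add: "tev (\<lambda>xs. f xs + g xs) t = tev f t + tev g t"
  by (induction t) (auto simp: tev_Cons algebra_simps)

lemma tev_scale: "tev (\<lambda>xs. c * f xs) t = c * tev f t"
  by (induction t) (auto simp: tev_Cons algebra_simps)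

lemma tev_0 [simp]: "tev (\<lambda>xs. 0) t = 0"
  by (induction t) (auto simp: tev_Cons)

lemma tev_sum: "tev (\<lambda>xs. \<Sum>i\<in>I. f i xs) t = (\<Sum>i\<in>I. tev (f i) t)"
  by (induction I rule: infinite_finite_induct) (auto simp: tev_add)

lemma tev_cong: "wf_ten k t \<Longrightarrow> (\<And>xs. length xs = k \<Longrightarrow> f xs = g xs) \<Longrightarrow> tev f t = tev g t"
  by (induction t) (auto simp: tev_Cons wf_ten_def)

lemma clin_tev:
  assumes "wf_ten k t" "\<And>ys. length ys = k \<Longrightarrow> clin ofX (\<lambda>a. f a ys)"
  shows "clin ofX (\<lambda>a. tev (f a) t)"
  using assms
  by (induction t) (auto simp: tev_Cons wf_ten_def intro!: clin_plus clin_scale clin_const_0)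

section \<open>Path sums\<close>

text \<open>The value of a multilinear functional on the sum of all elementary tensors
  \<open>(T\<^sub>0)\<^sub>i\<^sub>k \<otimes> (T\<^sub>1)\<^sub>k\<^sub>l \<otimes> \<dots>\<close> with first index \<open>i\<close>, last index \<open>j\<close>.\<close>

primrec psum :: "nat \<Rightarrow> (nat \<Rightarrow> nat \<Rightarrow> 'a) list \<Rightarrow> ('a list \<Rightarrow> complex) \<Rightarrow> nat \<Rightarrow> nat \<Rightarrow> complex" where
  "psum K [] \<phi> i j = (if i = j then \<phi> [] else 0)"
| "psum K (T # Ts) \<phi> i j = (\<Sum>k<K. psum K Ts (\<lambda>xs. \<phi> (T i k # xs)) k j)"

lemma psum_cong:
  "(\<And>xs. length xs = length Ts \<Longrightarrow> \<phi> xs = \<psi> xs) \<Longrightarrow> psum K Ts \<phi> i j = psum K Ts \<psi> i j"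
proof (induction Ts arbitrary: \<phi> \<psi> i)
  case (Cons T Ts)
  show ?case using Cons.prems by (auto intro!: sum.cong Cons.IH)
qed simp

lemma psum_0 [simp]: "psum K Ts (\<lambda>xs. 0) i j = 0"
  by (induction Ts arbitrary: i) auto

lemma psum_add: "psum K Ts (\<lambda>xs. \<phi> xs + \<psi> xs) i j = psum K Ts \<phi> i j + psum K Ts \<psi> i j"
  by (induction Ts arbitrary: \<phi> \<psi> i) (auto simp: sum.distrib)

lemma psum_scale: "psum K Ts (\<lambda>xs. c * \<phi> xs) i j = c * psum K Ts \<phi> i j"
  by (induction Ts arbitrary: \<phi> i) (auto simp: sum_distrib_left)

lemma psum_sum: "psum K Ts (\<lambda>xs. \<Sum>l\<in>I. \<phi> l xs) i j = (\<Sum>l\<in>I. psum K Ts (\<phi> l) i j)"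
  by (induction I rule: infinite_finite_induct) (auto simp: psum_add)

text \<open>The interchange brings a coproduct sum next to a single matrix entry, where equivariance
  applies.\<close>

lemma psum_tev: "psum K Ts (\<lambda>xs. tev (f xs) t) i j = tev (\<lambda>ys. psum K Ts (\<lambda>xs. f xs ys) i j) t"
  by (induction t) (auto simp: tev_Cons psum_add psum_scale)

text \<open>Paths are cut at their last edge instead of the first, because rotation acts on the last
  tensor factor.\<close>

lemma psum_snoc:
  assumes "i < K" "j < K"
  shows "psum K (Ts @ [T]) \<phi> i j = (\<Sum>k<K. psum K Ts (\<lambda>xs. \<phi> (xs @ [T k j])) i k)"
  using assms(1)
proof (induction Ts arbitrary: \<phi> i)
  case Nil
  have "(\<Sum>k<K. if i = k then \<phi> [T k j] else 0) = \<phi> [T i j]" using Nil by simp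
  moreover have "(\<Sum>k<K. if k = j then \<phi> [T i k] else 0) = \<phi> [T i j]" using assms(2) by simp
  ultimately show ?case using Nil assms(2) by simp
next
  case (Cons S Ts)
  then show ?case by (simp, subst sum.swap) simp
qed

text \<open>After merging, the index shared by \<open>X\<close> and \<open>Y\<close> occurs in one
  slot only, so by linearity its sum moves into that slot and becomes a matrix product.\<close>

lemma psum_merge:
  assumes "\<And>i j. i < K \<Longrightarrow> j < K \<Longrightarrow> (\<Sum>k<K. X i k * Y k j) = Z i j"
    and "multilin ofA (Suc (length As + length Bs)) \<phi>" and "i < K"
  shows "psum K (As @ X # Y # Bs) (\<lambda>xs. \<phi> (merge_at (length As) xs)) i j = psum K (As @ Z # Bs) \<phi> i j"
  using assms(2,3)
proof (induction As arbitrary: \<phi> i)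
  case Nil
  have "psum K Bs (\<lambda>xs. \<phi> (Z i l # xs)) l j = (\<Sum>k<K. psum K Bs (\<lambda>xs. \<phi> (X i k * Y k l # xs)) l j)"
    if "l < K" for l
    unfolding psum_sum[symmetric] assms(1)[OF Nil(2) that, symmetric]
    using clin_sum[OF multilin_hd] Nil(1) by (intro psum_cong) fastforce
  then show ?case
    by (simp add: merge_at_def) (subst sum.swap, simp)
next
  case (Cons T As)
  have "merge_at (Suc n) (a # xs) = a # merge_at n xs" for n and a :: 'a and xs
    by (simp add: merge_at_def)
  then show ?case using Cons.IH[of "\<lambda>xs. \<phi> (T i _ # xs)"] Cons.prems
    by (auto simp: multilin_Suc intro!: sum.cong)
qed

lemma psum_lincomb:
  assumes "multilin ofA (Suc (length As + length Bs)) \<phi>"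
  shows "psum K (As @ (\<lambda>i j. X i j + ofA t * Y i j) # Bs) \<phi> i j
    = psum K (As @ X # Bs) \<phi> i j + t * psum K (As @ Y # Bs) \<phi> i j"
  using assms
proof (induction As arbitrary: \<phi> i)
  case Nil
  have "psum K Bs (\<lambda>xs. \<phi> ((X i k + ofA t * Y i k) # xs)) k j =
    psum K Bs (\<lambda>xs. \<phi> (X i k # xs)) k j + t * psum K Bs (\<lambda>xs. \<phi> (Y i k # xs)) k j" for k
    unfolding psum_scale[symmetric] psum_add[symmetric]
    using multilin_hd[OF Nil] by (intro psum_cong) (auto simp: clin_def)
  then show ?case by (simp add: sum.distrib sum_distrib_left)
next
  case (Cons T As)
  show ?case using Cons.IH[OF multilin_Cons] Cons.prems by (simp add: sum.distrib sum_distrib_left)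
qed

lemma psum_zero_entry:
  "multilin ofA (Suc (length Ts)) \<phi> \<Longrightarrow> psum K Ts (\<lambda>xs. \<phi> (0 # xs)) i j = 0"
  using clin_0[OF multilin_hd] psum_cong[of Ts "\<lambda>xs. \<phi> (0 # xs)" "\<lambda>xs. 0" K i j] by fastforce

lemma sum_list_n_lists_Suc:
  "sum_list (map F (List.n_lists (Suc n) [0..<K])) =
     (\<Sum>i<K. sum_list (map (\<lambda>ys. F (i # ys)) (List.n_lists n [0..<K])))"
proof -
  have "sum_list (map F (concat (map (\<lambda>ys. map (\<lambda>y. y # ys) [0..<K]) yss)))
      = (\<Sum>i<K. sum_list (map (\<lambda>ys. F (i # ys)) yss))" for yss
    by (induction yss) (simp_all add: sum.distrib comp_def interv_sum_list_conv_sum_set_nat atLeast0LessThan)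
  then show ?thesis by simp
qed

text \<open>The weight \<open>g\<close> on the end point is arbitrary, so that the induction may
  move the start point; in the trace it is the row \<open>\<rho> h i\<close>.\<close>

lemma psum_n_lists:
  "i < K \<Longrightarrow> sum_list (map (\<lambda>ys. g ((i # ys) ! length Ts) *
       \<phi> (map (\<lambda>k. (Ts ! k) ((i # ys) ! k) (ys ! k)) [0..<length Ts])) (List.n_lists (length Ts) [0..<K]))
   = (\<Sum>j<K. g j * psum K Ts \<phi> i j)"
proof (induction Ts arbitrary: \<phi> i)
  case Nil
  have "(\<Sum>j<K. g j * (if i = j then \<phi> [] else 0)) = (\<Sum>j<K. if i = j then g j * \<phi> [] else 0)"
    by (intro sum.cong) auto
  then show ?case using Nil by simp
next
  case (Cons T Ts)
  have *: "map (\<lambda>k. ((T # Ts) ! k) ((i # l # ys) ! k) ((l # ys) ! k)) [0..<Suc (length Ts)]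
     = T i l # map (\<lambda>k. (Ts ! k) ((l # ys) ! k) (ys ! k)) [0..<length Ts]" for l ys
    by (subst upt_conv_Cons, simp, simp add: map_Suc_upt[symmetric] del: upt_Suc)
  show ?case
    unfolding length_Cons sum_list_n_lists_Suc *
    using Cons.IH[where \<phi> = "\<lambda>xs. \<phi> (T i _ # xs)"]
    by (simp add: sum_distrib_left) (subst sum.swap, simp)
qed

lemma tev_Tr_sigma:
  "tev \<phi> (Tr_sigma K \<rho> Ts h) = (\<Sum>i<K. \<Sum>j<K. \<rho> h i j * psum K Ts \<phi> i j)"
proof -
  have "tev \<phi> (Tr_sigma K \<rho> Ts h) = sum_list (map (\<lambda>is. \<rho> h (is ! 0) (is ! length Ts) *
      \<phi> (map (\<lambda>k. (Ts ! k) (is ! k) (is ! Suc k)) [0..<length Ts])) (List.n_lists (Suc (length Ts)) [0..<K]))"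
    by (simp add: tev_def Tr_sigma_def comp_def)
  also have "\<dots> = (\<Sum>i<K. \<Sum>j<K. \<rho> h i j * psum K Ts \<phi> i j)"
    unfolding sum_list_n_lists_Suc using psum_n_lists by (intro sum.cong) auto
  finally show ?thesis .
qed

lemma wf_Tr_sigma: "wf_ten (length Ts) (Tr_sigma K \<rho> Ts h)"
  by (auto simp: wf_ten_def Tr_sigma_def)

section \<open>Iterated coproducts\<close>

lemma tev_copn_Suc: "tev \<psi> (copn cop (Suc n) h) =
    tev (\<lambda>xs. tev (\<lambda>ys. \<psi> (butlast xs @ ys)) (cop (last xs))) (copn cop n h)"
  by simp

locale hopf_module_algebra =
  fixes ofU :: "complex \<Rightarrow> 'u::ring_1" and cop :: "'u \<Rightarrow> 'u ten"
    and eps :: "'u \<Rightarrow> complex" and S :: "'u \<Rightarrow> 'u"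
    and ofA :: "complex \<Rightarrow> 'a::ring_1" and act :: "'u \<Rightarrow> 'a \<Rightarrow> 'a"
  assumes hopf: "hopf_algebra ofU cop eps S"
    and modalg: "module_algebra ofU cop eps ofA act"
begin

lemma wf_cop: "wf_ten 2 (cop h)"
  using hopf by (simp add: hopf_algebra_def)

lemma wf_copn: "wf_ten (Suc n) (copn cop n h)"
proof (induction n)
  case (Suc n)
  show ?case
    unfolding wf_ten_def
  proof safe
    fix c xs assume "(c, xs) \<in> set (copn cop (Suc n) h)"
    then obtain d ys e zs where "(d, ys) \<in> set (copn cop n h)" "(e, zs) \<in> set (cop (last ys))"
      "xs = butlast ys @ zs"
      by (force simp: tbind_def tscale_def)
    then show "length xs = Suc (Suc n)"
      using Suc wf_cop[of "last ys"] by (fastforce simp: wf_ten_def)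
  qed
qed (simp add: wf_ten_def)

text \<open>\<open>cop (g + h)\<close> and \<open>cop g @ cop h\<close> are different lists in
  general; the coproduct is linear only after a bilinear functional has been applied.\<close>

lemma clin_tev_cop:
  assumes "\<And>b. clin ofU (\<lambda>a. B a b)" "\<And>a. clin ofU (B a)"
  shows "clin ofU (\<lambda>h. tev (\<lambda>ys. B (ys ! 0) (ys ! 1)) (cop h))"
proof -
  have *: "teq ofU 2 (cop (g + h)) (cop g @ cop h)" "teq ofU 2 (cop (ofU c * h)) (tscale c (cop h))"
    for g h c using hopf by (simp_all add: hopf_algebra_def)
  show ?thesis
    using *[unfolded teq_def, rule_format, OF multilin_2[of ofU B, OF assms]]
    by (simp add: clin_def)
qed

lemma coassoc:
  assumes "\<And>b c. clin ofU (\<lambda>a. B a b c)" "\<And>a c. clin ofU (\<lambda>b. B a b c)" "\<And>a b. clin ofU (B a b)"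
  shows "tev (\<lambda>xs. tev (\<lambda>ys. B (ys ! 0) (ys ! 1) (xs ! 1)) (cop (xs ! 0))) (cop h)
    = tev (\<lambda>xs. tev (\<lambda>ys. B (xs ! 0) (ys ! 0) (ys ! 1)) (cop (xs ! 1))) (cop h)"
proof -
  have "teq ofU 3
        (tbind (cop h) (\<lambda>xs. tbind (cop (xs!0)) (\<lambda>ys. [(1, [ys!0, ys!1, xs!1])])))
        (tbind (cop h) (\<lambda>xs. tbind (cop (xs!1)) (\<lambda>ys. [(1, [xs!0, ys!0, ys!1])])))"
    using hopf by (simp add: hopf_algebra_def)
  from this[unfolded teq_def, rule_format, OF multilin_3[of ofU B], OF assms] show ?thesis
    by (simp add: eval_nat_numeral)
qed

text \<open>Both sides are the same right comb of coproducts, unrolled from the deepest split or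
  from the outermost one; only list shapes have to be matched.\<close>

lemma tev_copn_Cons:
  "tev \<psi> (copn cop (Suc n) h) = tev (\<lambda>ys. tev (\<lambda>hs. \<psi> (ys ! 0 # hs)) (copn cop n (ys ! 1))) (cop h)"
proof (induction n arbitrary: \<psi>)
  case 0
  show ?case by (auto intro!: tev_cong[OF wf_cop] simp: numeral_2_eq_2 length_Suc_conv)
next
  case (Suc n)
  show ?case
    by (subst tev_copn_Suc, subst Suc.IH, subst tev_copn_Suc,
        intro tev_cong[OF wf_cop] tev_cong[OF wf_copn]) (auto simp: length_Suc_conv)
qed

lemma clin_tev_copn:
  "multilin ofU (Suc n) \<psi> \<Longrightarrow> clin ofU (\<lambda>h. tev \<psi> (copn cop n h))"
proof (induction n arbitrary: \<psi>)
  case 0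
  then show ?case by (simp add: multilin_Suc)
next
  case (Suc n)
  show ?case unfolding tev_copn_Cons
    by (rule clin_tev_cop[where B = "\<lambda>a b. tev (\<lambda>hs. \<psi> (a # hs)) (copn cop n b)"])
      (auto intro!: clin_tev[OF wf_copn] multilin_hd[OF Suc.prems] Suc.IH multilin_Cons[OF Suc.prems])
qed

text \<open>After the first leg is split off in front, this is ordinary coassociativity whose middle
  slot carries the remaining iterated coproduct. It frees the first leg for one tensor factor and
  leaves the same pattern, one factor shorter, on the second leg.\<close>

lemma tev_copn_coassoc:
  assumes "multilin ofU (Suc (Suc (Suc n))) \<psi>"
  shows "tev (\<lambda>ys. tev (\<lambda>hs. \<psi> (hs @ [ys ! 1])) (copn cop (Suc n) (ys ! 0))) (cop h)
    = tev (\<lambda>ys. tev (\<lambda>zs. tev (\<lambda>hs. \<psi> (ys ! 0 # hs @ [zs ! 1])) (copn cop n (zs ! 0))) (cop (ys ! 1))) (cop h)"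
proof -
  note m = multilin_Cons[OF assms]
  show ?thesis
    unfolding tev_copn_Cons append_Cons
  proof (rule coassoc[where B = "\<lambda>a b c. tev (\<lambda>hs. \<psi> (a # hs @ [c])) (copn cop n b)"])
    fix a b c
    show "clin ofU (\<lambda>a. tev (\<lambda>hs. \<psi> (a # hs @ [c])) (copn cop n b))"
      by (rule clin_tev[OF wf_copn]) (auto intro!: multilin_hd[OF assms])
    show "clin ofU (\<lambda>b. tev (\<lambda>hs. \<psi> (a # hs @ [c])) (copn cop n b))"
      using multilin_snoc[OF m] by (intro clin_tev_copn) simp
    show "clin ofU (\<lambda>c. tev (\<lambda>hs. \<psi> (a # hs @ [c])) (copn cop n b))"
      by (rule clin_tev[OF wf_copn]) (use multilin_last[OF m] in simp)
  qed
qed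

section \<open>The module algebra action under linear functionals\<close>

lemma act_add: "act h (a + b) = act h a + act h b"
  and act_scale: "act h (ofA c * a) = ofA c * act h a"
  and act_add_left: "act (g + h) a = act g a + act h a"
  and act_scale_left: "act (ofU c * h) a = ofA c * act h a"
  and act_mult: "act h (a * b) =
        sum_list (map (\<lambda>(c, xs). ofA c * (act (xs!0) a * act (xs!1) b)) (cop h))"
  using modalg unfolding module_algebra_def by blast+

lemma act_0: "act h 0 = 0"
  by (metis act_add add_cancel_right_right)

lemma act_sum: "act h (\<Sum>i\<in>I. f i) = (\<Sum>i\<in>I. act h (f i))"
  by (induction I rule: infinite_finite_induct) (auto simp: act_0 act_add)

lemma ofA_1: "ofA 1 = 1" and ofA_add: "ofA (c + d) = ofA c + ofA d"
  and ofA_comm: "ofA c * x = x * ofA c"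
  proof -
  have "cplx_alg ofA" using modalg unfolding module_algebra_def by blast
  then show "ofA 1 = 1" "ofA (c + d) = ofA c + ofA d" "ofA c * x = x * ofA c"
    unfolding cplx_alg_def by blast+
qed

lemma ofA_0: "ofA 0 = 0"
  by (metis ofA_add add_cancel_right_right)

lemma clin_act_left: "clin ofA L \<Longrightarrow> clin ofU (\<lambda>h. L (act h a))"
  by (simp add: clin_def act_add_left act_scale_left)

lemma clin_mult_right: "clin ofA L \<Longrightarrow> clin ofA (\<lambda>a. L (a * b))"
  by (simp add: clin_def distrib_right mult.assoc)

lemma clin_mult_left: "clin ofA L \<Longrightarrow> clin ofA (\<lambda>a. L (b * a))"
  unfolding clin_def by (metis distrib_left mult.assoc ofA_comm)

lemma clin_act_mult:
  assumes "clin ofA L"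
  shows "L (act h (a * b)) = tev (\<lambda>ys. L (act (ys ! 0) a * act (ys ! 1) b)) (cop h)"
  using assms unfolding act_mult clin_sum_list[OF assms] tev_def
  by (auto simp: comp_def clin_def intro!: arg_cong[of _ _ sum_list])

section \<open>Equivariant matrices\<close>

text \<open>\<open>(h\<^sub>(\<^sub>1\<^sub>) \<triangleright> X) \<tau>(h\<^sub>(\<^sub>2\<^sub>))\<^sup>t = \<sigma>(h)\<^sup>t X\<close>, tested against linear functionals so that
  coassociativity, which is only available for functionals, applies directly.\<close>

definition eqv where
  "eqv N \<sigma> M \<tau> X \<longleftrightarrow> (\<forall>L h. clin ofA L \<longrightarrow> (\<forall>i<N. \<forall>m<M.
     tev (\<lambda>ys. \<Sum>j<M. \<tau> (ys ! 1) m j * L (act (ys ! 0) (X i j))) (cop h)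
       = (\<Sum>k<N. \<sigma> h k i * L (X k m))))"

definition rep :: "nat \<Rightarrow> ('u \<Rightarrow> nat \<Rightarrow> nat \<Rightarrow> complex) \<Rightarrow> bool" where
  "rep K \<rho> \<longleftrightarrow> (\<forall>i<K. \<forall>j<K. clin ofU (\<lambda>h. \<rho> h i j) \<and>
     (\<forall>g h. \<rho> (g * h) i j = (\<Sum>k<K. \<rho> g i k * \<rho> h k j)))"

lemma eqvD: "eqv N \<sigma> M \<tau> X \<Longrightarrow> clin ofA L \<Longrightarrow> i < N \<Longrightarrow> m < M \<Longrightarrow>
     tev (\<lambda>ys. \<Sum>j<M. \<tau> (ys ! 1) m j * L (act (ys ! 0) (X i j))) (cop h)
       = (\<Sum>k<N. \<sigma> h k i * L (X k m))"
  by (simp add: eqv_def)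

lemma eqv_lincomb:
  assumes "eqv N \<sigma> M \<tau> X" "eqv N \<sigma> M \<tau> Y"
  shows "eqv N \<sigma> M \<tau> (\<lambda>i j. X i j + ofA c * Y i j)"
  unfolding eqv_def
proof (intro allI impI)
  fix L h i m assume L: "clin ofA L" and im: "i < N" "m < M"
  have *: "L (a + ofA c * b) = L a + c * L b" for a b
    using L by (simp add: clin_def)
  show "tev (\<lambda>ys. \<Sum>j<M. \<tau> (ys ! 1) m j * L (act (ys ! 0) (X i j + ofA c * Y i j))) (cop h)
       = (\<Sum>k<N. \<sigma> h k i * L (X k m + ofA c * Y k m))"
    using eqvD[OF assms(1) L im, of h] eqvD[OF assms(2) L im, of h]
    by (simp add: act_add act_scale * distrib_left sum.distrib tev_add tev_scale
        sum_distrib_left[symmetric] mult.left_commute[of _ c])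
qed

lemma eqv_0: "eqv N \<sigma> M \<tau> (\<lambda>i j. 0)"
  by (simp add: eqv_def act_0 clin_0)

text \<open>The left factor \<open>x\<close> is arbitrary; this is what makes the inverse of an equivariant isomorphism
  equivariant.\<close>

lemma eqv_mult_right:
  assumes Y: "eqv N \<sigma> P \<kappa> Y" and \<kappa>: "rep P \<kappa>" and L: "clin ofA L" and m: "m < P"
  shows "tev (\<lambda>ys. \<Sum>j<P. \<kappa> (ys ! 1) m j * L (act (ys ! 0) (\<Sum>k<N. x k * Y k j))) (cop h)
    = tev (\<lambda>ys. \<Sum>k<N. \<Sum>l<N. \<sigma> (ys ! 1) l k * L (act (ys ! 0) (x k) * Y l m)) (cop h)"
proof -
  have \<kappa>': "clin ofU (\<lambda>h. \<kappa> h m j)" if "j < P" for j using \<kappa> m that by (simp add: rep_def)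
  \<comment> \<open>The action on a product splits the first leg. Coassociativity moves this split
    to the second leg, so that \<open>Y\<close> and \<open>\<kappa>\<close> share one coproduct and
    the equivariance of \<open>Y\<close> applies.\<close>
  have c: "tev (\<lambda>ys. tev (\<lambda>zs. \<kappa> (ys ! 1) m j * L (act (zs ! 0) (x k) * act (zs ! 1) (Y k j))) (cop (ys ! 0))) (cop h)
    = tev (\<lambda>ys. tev (\<lambda>zs. \<kappa> (zs ! 1) m j * L (act (ys ! 0) (x k) * act (zs ! 0) (Y k j))) (cop (ys ! 1))) (cop h)"
    if "j < P" for j k
    by (rule coassoc[where B = "\<lambda>a b c. \<kappa> c m j * L (act a (x k) * act b (Y k j))"])
      (use \<kappa>'[OF that] in \<open>auto intro!: clin_scale clin_scale_right clin_act_left clin_act_left[where L = "\<lambda>a. L (a * _)"]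
        clin_act_left[where L = "\<lambda>a. L (_ * a)"] clin_mult_right clin_mult_left L\<close>)
  have "tev (\<lambda>ys. \<Sum>j<P. \<kappa> (ys ! 1) m j * L (act (ys ! 0) (\<Sum>k<N. x k * Y k j))) (cop h)
    = (\<Sum>j<P. \<Sum>k<N. tev (\<lambda>ys. tev (\<lambda>zs. \<kappa> (ys ! 1) m j * L (act (zs ! 0) (x k) * act (zs ! 1) (Y k j))) (cop (ys ! 0))) (cop h))"
    by (simp add: act_sum clin_sum[OF L] clin_act_mult[OF L] sum_distrib_left tev_scale tev_sum)
  also have "\<dots> = (\<Sum>k<N. \<Sum>j<P. tev (\<lambda>ys. tev (\<lambda>zs. \<kappa> (zs ! 1) m j * L (act (ys ! 0) (x k) * act (zs ! 0) (Y k j))) (cop (ys ! 1))) (cop h))"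
    by (subst sum.swap) (simp add: c del: One_nat_def)
  also have "\<dots> = tev (\<lambda>ys. \<Sum>k<N. tev (\<lambda>zs. \<Sum>j<P. \<kappa> (zs ! 1) m j * L (act (ys ! 0) (x k) * act (zs ! 0) (Y k j))) (cop (ys ! 1))) (cop h)"
    by (simp add: tev_sum)
  also have "\<dots> = tev (\<lambda>ys. \<Sum>k<N. \<Sum>l<N. \<sigma> (ys ! 1) l k * L (act (ys ! 0) (x k) * Y l m)) (cop h)"
    using eqvD[OF Y clin_mult_left[OF L] _ m] by simp
  finally show ?thesis .
qed

text \<open>Insert v = v e and pull e out of the action, replace it by u v, draw u back under the
  action to form v u = f, pull f out, and absorb it by f v = v. The two uses of
  \<open>eqv_mult_right\<close> run in opposite directions.\<close>

lemma eqv_inverse: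
  assumes \<sigma>: "rep N \<sigma>" and \<tau>: "rep M \<tau>"
    and e: "eqv N \<sigma> N \<sigma> e" and f: "eqv M \<tau> M \<tau> f" and u: "eqv N \<sigma> M \<tau> u"
    and uv: "\<And>i j. i < N \<Longrightarrow> j < N \<Longrightarrow> (\<Sum>k<M. u i k * v k j) = e i j"
    and vu: "\<And>i j. i < M \<Longrightarrow> j < M \<Longrightarrow> (\<Sum>k<N. v i k * u k j) = f i j"
    and ve: "\<And>i j. i < M \<Longrightarrow> j < N \<Longrightarrow> (\<Sum>k<N. v i k * e k j) = v i j"
    and fv: "\<And>i j. i < M \<Longrightarrow> j < N \<Longrightarrow> (\<Sum>k<M. f i k * v k j) = v i j"
  shows "eqv M \<tau> N \<sigma> v"
  unfolding eqv_def
proof (intro allI impI)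
  fix L h i m assume L: "clin ofA L" and im: "i < M" "m < N"
  have "tev (\<lambda>ys. \<Sum>j<N. \<sigma> (ys ! 1) m j * L (act (ys ! 0) (v i j))) (cop h)
    = tev (\<lambda>ys. \<Sum>j<N. \<sigma> (ys ! 1) m j * L (act (ys ! 0) (\<Sum>k<N. v i k * e k j))) (cop h)"
    by (simp add: ve im)
  also have "\<dots> = tev (\<lambda>ys. \<Sum>k<N. \<Sum>l<N. \<sigma> (ys ! 1) l k * L (act (ys ! 0) (v i k) * e l m)) (cop h)"
    by (rule eqv_mult_right[OF e \<sigma> L im(2)])
  also have "\<dots> = tev (\<lambda>ys. \<Sum>p<M. \<Sum>k<N. \<Sum>l<N. \<sigma> (ys ! 1) l k * L (act (ys ! 0) (v i k) * u l p * v p m)) (cop h)"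
    by (simp add: im uv[symmetric] sum_distrib_left clin_sum[OF L] mult.assoc)
      (simp add: sum.swap[of _ "{..<M}"])
  also have "\<dots> = (\<Sum>p<M. tev (\<lambda>ys. \<Sum>k<N. \<Sum>l<N. \<sigma> (ys ! 1) l k * L (act (ys ! 0) (v i k) * u l p * v p m)) (cop h))"
    by (rule tev_sum)
  also have "\<dots> = (\<Sum>p<M. tev (\<lambda>ys. \<Sum>q<M. \<tau> (ys ! 1) p q * L (act (ys ! 0) (\<Sum>k<N. v i k * u k q) * v p m)) (cop h))"
    by (intro sum.cong refl eqv_mult_right[OF u \<tau> clin_mult_right[OF L], symmetric]) simp
  also have "\<dots> = (\<Sum>p<M. tev (\<lambda>ys. \<Sum>q<M. \<tau> (ys ! 1) p q * L (act (ys ! 0) (f i q) * v p m)) (cop h))"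
    by (simp add: vu im)
  also have "\<dots> = (\<Sum>p<M. \<Sum>s<M. \<tau> h s i * L (f s p * v p m))"
    using eqvD[OF f clin_mult_right[OF L] im(1)] by simp
  also have "\<dots> = (\<Sum>s<M. \<tau> h s i * L (v s m))"
    by (subst sum.swap) (simp add: fv[symmetric] im clin_sum[OF L] sum_distrib_left)
  finally show "tev (\<lambda>ys. \<Sum>j<N. \<sigma> (ys ! 1) m j * L (act (ys ! 0) (v i j))) (cop h)
    = (\<Sum>s<M. \<tau> h s i * L (v s m))" .
qed

end

section \<open>Traces of equivariant matrices: chain condition, rotation and faces\<close>

lemma multilin_snocI:
  "(\<And>y. multilin ofX k (\<lambda>xs. \<psi> (xs @ [y]))) \<Longrightarrow> (\<And>xs. length xs = k \<Longrightarrow> clin ofX (\<lambda>y. \<psi> (xs @ [y])))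
    \<Longrightarrow> multilin ofX (Suc k) \<psi>"
proof (induction k arbitrary: \<psi>)
  case 0
  from 0(2)[of "[]"] show ?case by (simp add: multilin_Suc)
next
  case (Suc k)
  have "clin ofX (\<lambda>a. \<psi> (a # xs))" if "length xs = Suc k" for xs
    using that multilin_hd[OF Suc.prems(1), of "butlast xs" "last xs"]
    by (cases xs rule: rev_cases) auto
  moreover have "multilin ofX (Suc k) (\<lambda>xs. \<psi> (a # xs))" for a
  proof (rule Suc.IH)
    show "multilin ofX k (\<lambda>xs. \<psi> (a # xs @ [y]))" for y
      using multilin_Cons[OF Suc.prems(1)] by simp
    show "clin ofX (\<lambda>y. \<psi> (a # xs @ [y]))" if "length xs = k" for xs
      using Suc.prems(2)[of "a # xs"] that by simp
  qed
  ultimately show ?case unfolding multilin_Suc[of _ "Suc k"] by blast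
qed

lemma clin_psum:
  "(\<And>as. length as = length Ts \<Longrightarrow> clin ofX (\<lambda>a. F a as)) \<Longrightarrow> clin ofX (\<lambda>a. psum K Ts (F a) i j)"
proof (induction Ts arbitrary: F i)
  case (Cons T Ts)
  show ?case by (auto intro!: clin_Sum Cons)
next
  case Nil
  then show ?case by (cases "i = j") (auto simp: clin_const_0)
qed

lemma sum_swap3: "(\<Sum>i\<in>A. \<Sum>m\<in>B. \<Sum>k\<in>C. F i m k) = (\<Sum>k\<in>C. \<Sum>m\<in>B. \<Sum>i\<in>A. F i m k)"
proof -
  have "(\<Sum>i\<in>A. \<Sum>m\<in>B. \<Sum>k\<in>C. F i m k) = (\<Sum>m\<in>B. \<Sum>i\<in>A. \<Sum>k\<in>C. F i m k)"
    by (rule sum.swap)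
  also have "\<dots> = (\<Sum>m\<in>B. \<Sum>k\<in>C. \<Sum>i\<in>A. F i m k)"
    by (intro sum.cong refl sum.swap)
  also have "\<dots> = (\<Sum>k\<in>C. \<Sum>m\<in>B. \<Sum>i\<in>A. F i m k)"
    by (rule sum.swap)
  finally show ?thesis .
qed

lemma psum_single: "j < K \<Longrightarrow> psum K [T] \<phi> i j = \<phi> [T i j]"
  by simp

context hopf_module_algebra
begin

lemma multilin_map2_act:
  "multilin ofA k \<phi> \<Longrightarrow> length as = k \<Longrightarrow> multilin ofU k (\<lambda>hs. \<phi> (map2 act hs as))"
proof (induction as arbitrary: k \<phi>)
  case (Cons a as)
  then obtain k' where k: "k = Suc k'" "length as = k'" by auto
  have "clin ofU (\<lambda>h. \<phi> (act h a # map2 act hs as))" if "length hs = k'" for hs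
    using clin_act_left[OF multilin_hd] Cons.prems(1) k that by simp
  then show ?case
    using Cons.IH[OF multilin_Cons] Cons.prems k by (simp add: multilin_Suc)
qed simp

text \<open>The matrix of tensors \<open>T_0 \<otimes> ... \<otimes> T_n\<close> is again
  equivariant. By induction the tail passes the representation from its right end to its left end,
  where it meets the column index of the first factor and is passed on by the equivariance of that
  factor.\<close>

lemma psum_coact:
  assumes \<rho>: "rep K \<rho>" and "\<forall>T\<in>set Ts. eqv K \<rho> K \<rho> T" and "length Ts = Suc n"
    and "multilin ofA (Suc n) \<phi>" and "i < K" and m: "m < K"
  shows "tev (\<lambda>ys. tev (\<lambda>hs. \<Sum>j<K. \<rho> (ys ! 1) m j * psum K Ts (\<lambda>as. \<phi> (map2 act hs as)) i j)
      (copn cop n (ys ! 0))) (cop h) = (\<Sum>k<K. \<rho> h k i * psum K Ts \<phi> k m)"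
  using assms(2-5)
proof (induction n arbitrary: Ts \<phi> i h)
  case 0
  then obtain T where Ts: "Ts = [T]" by (auto simp: length_Suc_conv)
  have "clin ofA (\<lambda>a. \<phi> [a])" using 0 by (simp add: multilin_Suc)
  then show ?case using 0 eqvD[of K \<rho> K \<rho> T "\<lambda>a. \<phi> [a]" i m h] m unfolding Ts
    by (simp add: psum_single del: psum.simps)
next
  case (Suc n)
  then obtain T Us where Ts: "Ts = T # Us" "length Us = Suc n" by (auto simp: length_Suc_conv)
  \<comment> \<open>All legs are collected in one list, the last for \<rho> and the others for the
    action, so that \<open>tev_copn_coassoc\<close> can regroup them.\<close>
  define \<psi> where "\<psi> = (\<lambda>l. \<Sum>j<K. \<rho> (last l) m j * psum K Ts (\<lambda>as. \<phi> (map2 act (butlast l) as)) i j)"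
  have \<rho>': "clin ofU (\<lambda>h. \<rho> h m j)" if "j < K" for j
    using \<rho> m that by (simp add: rep_def)
  have \<psi>: "multilin ofU (Suc (Suc (Suc n))) \<psi>"
  proof (rule multilin_snocI)
    fix y
    show "multilin ofU (Suc (Suc n)) (\<lambda>xs. \<psi> (xs @ [y]))"
      unfolding \<psi>_def multilin_clin
      using multilin_map2_act[OF Suc.prems(3)] Ts
      by (auto intro!: clin_Sum clin_scale clin_psum simp: multilin_clin)
  next
    fix xs :: "'u list" assume "length xs = Suc (Suc n)"
    show "clin ofU (\<lambda>y. \<psi> (xs @ [y]))"
      unfolding \<psi>_def by (auto intro!: clin_Sum clin_scale_right \<rho>')
  qed
  have "tev (\<lambda>ys. tev (\<lambda>hs. \<Sum>j<K. \<rho> (ys ! 1) m j * psum K Ts (\<lambda>as. \<phi> (map2 act hs as)) i j)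
      (copn cop (Suc n) (ys ! 0))) (cop h)
    = tev (\<lambda>ys. tev (\<lambda>hs. \<psi> (hs @ [ys ! 1])) (copn cop (Suc n) (ys ! 0))) (cop h)"
    by (simp add: \<psi>_def del: psum.simps copn.simps)
  also have "\<dots> = tev (\<lambda>ys. tev (\<lambda>zs. tev (\<lambda>hs. \<psi> (ys ! 0 # hs @ [zs ! 1])) (copn cop n (zs ! 0)))
      (cop (ys ! 1))) (cop h)"
    by (rule tev_copn_coassoc[OF \<psi>])
  also have "\<dots> = tev (\<lambda>ys. \<Sum>l<K. tev (\<lambda>zs. tev (\<lambda>hs. \<Sum>j<K. \<rho> (zs ! 1) m j *
      psum K Us (\<lambda>as. \<phi> (act (ys ! 0) (T i l) # map2 act hs as)) l j)
      (copn cop n (zs ! 0))) (cop (ys ! 1))) (cop h)"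
  proof -
    have "\<psi> (y # hs @ [z]) = (\<Sum>l<K. \<Sum>j<K. \<rho> z m j * psum K Us (\<lambda>as. \<phi> (act y (T i l) # map2 act hs as)) l j)"
      for y hs z
      by (simp add: \<psi>_def Ts sum_distrib_left butlast_append) (rule sum.swap)
    then show ?thesis by (simp add: tev_sum)
  qed
  also have "\<dots> = tev (\<lambda>ys. \<Sum>l<K. \<Sum>k<K. \<rho> (ys ! 1) k l * psum K Us (\<lambda>as. \<phi> (act (ys ! 0) (T i l) # as)) k m) (cop h)"
  proof -
    \<comment> \<open>This is the induction hypothesis for the tail, with the first slot of
      \<open>\<phi>\<close> frozen at an entry of \<open>T\<close> that has already been acted
      upon.\<close>
    have "tev (\<lambda>zs. tev (\<lambda>hs. \<Sum>j<K. \<rho> (zs ! 1) m j * psum K Us (\<lambda>as. \<phi> (act y (T i l) # map2 act hs as)) l j)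
        (copn cop n (zs ! 0))) (cop g) = (\<Sum>k<K. \<rho> g k l * psum K Us (\<lambda>as. \<phi> (act y (T i l) # as)) k m)"
      if "l < K" for l y g
      using Suc.prems Ts that by (intro Suc.IH multilin_Cons[OF Suc.prems(3)]) auto
    then show ?thesis by simp
  qed
  also have "\<dots> = tev (\<lambda>ys. \<Sum>k<K. psum K Us (\<lambda>as. \<Sum>l<K. \<rho> (ys ! 1) k l * \<phi> (act (ys ! 0) (T i l) # as)) k m) (cop h)"
    by (subst sum.swap) (simp add: psum_sum psum_scale)
  also have "\<dots> = (\<Sum>k<K. tev (\<lambda>ys. psum K Us (\<lambda>as. \<Sum>l<K. \<rho> (ys ! 1) k l * \<phi> (act (ys ! 0) (T i l) # as)) k m) (cop h))"
    by (rule tev_sum)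
  also have "\<dots> = (\<Sum>k<K. psum K Us (\<lambda>as. tev (\<lambda>ys. \<Sum>l<K. \<rho> (ys ! 1) k l * \<phi> (act (ys ! 0) (T i l) # as)) (cop h)) k m)"
    by (simp only: psum_tev)
  also have "\<dots> = (\<Sum>k<K. psum K Us (\<lambda>as. \<Sum>s<K. \<rho> h s i * \<phi> (T s k # as)) k m)"
  proof (intro sum.cong refl psum_cong)
    fix k as assume "k \<in> {..<K}" "length (as :: 'a list) = length Us"
    then show "tev (\<lambda>ys. \<Sum>l<K. \<rho> (ys ! 1) k l * \<phi> (act (ys ! 0) (T i l) # as)) (cop h) = (\<Sum>s<K. \<rho> h s i * \<phi> (T s k # as))"
      using Suc.prems Ts by (intro eqvD[where L = "\<lambda>a. \<phi> (a # as)"] multilin_hd[OF Suc.prems(3)]) auto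
  qed
  also have "\<dots> = (\<Sum>k<K. \<rho> h k i * psum K Ts \<phi> k m)"
    by (simp add: psum_sum psum_scale Ts sum_distrib_left) (rule sum.swap)
  finally show ?case .
qed

lemma chain_Tr_sigma:
  assumes \<rho>: "rep K \<rho>" and Ts: "\<forall>T\<in>set Ts. eqv K \<rho> K \<rho> T" "length Ts = Suc n"
  shows "chain ofU cop ofA act n (Tr_sigma K \<rho> Ts)"
  unfolding chain_def
proof (intro conjI allI)
  show "wf_ten (Suc n) (Tr_sigma K \<rho> Ts h)" for h
    using wf_Tr_sigma[of Ts] Ts by metis
  have \<rho>': "\<rho> (g + h) i j = \<rho> g i j + \<rho> h i j" "\<rho> (ofU c * h) i j = c * \<rho> h i j"
    "\<rho> (g * h) i j = (\<Sum>k<K. \<rho> g i k * \<rho> h k j)"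
    if "i < K" "j < K" for g h i j c
    using \<rho> that unfolding rep_def clin_def by blast+
  show "teq ofA (Suc n) (Tr_sigma K \<rho> Ts (g + h)) (Tr_sigma K \<rho> Ts g @ Tr_sigma K \<rho> Ts h)" for g h
    by (simp add: teq_def tev_Tr_sigma \<rho>'(1) distrib_right sum.distrib)
  show "teq ofA (Suc n) (Tr_sigma K \<rho> Ts (ofU c * h)) (tscale c (Tr_sigma K \<rho> Ts h))" for c h
    by (simp add: teq_def tev_Tr_sigma \<rho>'(2) sum_distrib_left mult.assoc)
  show "teq ofA (Suc n)
        (tbind (cop h) (\<lambda>ys. tact cop act n (ys!0) (Tr_sigma K \<rho> Ts (x * ys!1)))) (Tr_sigma K \<rho> Ts (h * x))" for h x
    unfolding teq_def
  proof (intro allI impI)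
    fix \<phi> :: "'a list \<Rightarrow> complex" assume \<phi>: "multilin ofA (Suc n) \<phi>"
    have "tev \<phi> (tbind (cop h) (\<lambda>ys. tact cop act n (ys!0) (Tr_sigma K \<rho> Ts (x * ys!1))))
      = tev (\<lambda>ys. tev (\<lambda>hs. \<Sum>i<K. \<Sum>j<K. \<rho> (x * ys ! 1) i j *
           psum K Ts (\<lambda>as. \<phi> (map2 act hs as)) i j) (copn cop n (ys ! 0))) (cop h)"
      by (simp add: tact_def tev_Tr_sigma)
    \<comment> \<open>Multiplicativity splits off \<rho>(x). \<open>psum_coact\<close> then turns
      the other factor into \<rho>(h), which lands to the left of \<rho>(x), and the two recombine
      to \<rho>(h x).\<close>
    also have "\<dots> = tev (\<lambda>ys. tev (\<lambda>hs. \<Sum>i<K. \<Sum>m<K. \<rho> x i m * (\<Sum>j<K. \<rho> (ys ! 1) m j *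
           psum K Ts (\<lambda>as. \<phi> (map2 act hs as)) i j)) (copn cop n (ys ! 0))) (cop h)"
    proof -
      have "(\<Sum>j<K. \<rho> (x * g) i j * p j) = (\<Sum>m<K. \<rho> x i m * (\<Sum>j<K. \<rho> g m j * p j))"
        if "i < K" for i g p
        using that by (simp add: \<rho>'(3) sum_distrib_left sum_distrib_right mult.assoc) (rule sum.swap)
      then show ?thesis by simp
    qed
    also have "\<dots> = (\<Sum>i<K. \<Sum>m<K. \<rho> x i m * tev (\<lambda>ys. tev (\<lambda>hs. \<Sum>j<K. \<rho> (ys ! 1) m j *
           psum K Ts (\<lambda>as. \<phi> (map2 act hs as)) i j) (copn cop n (ys ! 0))) (cop h))"
      by (simp only: tev_sum tev_scale)
    also have "\<dots> = (\<Sum>i<K. \<Sum>m<K. \<rho> x i m * (\<Sum>k<K. \<rho> h k i * psum K Ts \<phi> k m))"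
      using psum_coact[OF \<rho> Ts \<phi>] by simp
    also have "\<dots> = (\<Sum>k<K. \<Sum>m<K. \<Sum>i<K. \<rho> h k i * \<rho> x i m * psum K Ts \<phi> k m)"
      by (subst sum_swap3[symmetric]) (simp add: sum_distrib_left mult_ac)
    also have "\<dots> = tev \<phi> (Tr_sigma K \<rho> Ts (h * x))"
      by (simp add: tev_Tr_sigma \<rho>'(3) sum_distrib_right)
    finally show "tev \<phi> (tbind (cop h) (\<lambda>ys. tact cop act n (ys!0) (Tr_sigma K \<rho> Ts (x * ys!1))))
      = tev \<phi> (Tr_sigma K \<rho> Ts (h * x))" .
  qed
qed

text \<open>This is the twisted trace property: the column index of \<open>T\<close> is contracted
  with \<rho> of the second leg, so equivariance removes the action and makes the row index of
  \<rho>(h) the new start of the path. Linearity is asked for in the first slot only, which suits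
  functionals composed with \<open>merge_at 0\<close>.\<close>

lemma tev_Tr_rotate:
  assumes T: "eqv K \<rho> K \<rho> T" and \<phi>: "\<And>xs. length xs = length Ts \<Longrightarrow> clin ofA (\<lambda>a. \<phi> (a # xs))"
  shows "tev (\<lambda>ys. tev (\<lambda>as. \<phi> (act (ys ! 0) (last as) # butlast as)) (Tr_sigma K \<rho> (Ts @ [T]) (ys ! 1))) (cop h)
    = tev \<phi> (Tr_sigma K \<rho> (T # Ts) h)"
proof -
  have "tev (\<lambda>ys. tev (\<lambda>as. \<phi> (act (ys ! 0) (last as) # butlast as)) (Tr_sigma K \<rho> (Ts @ [T]) (ys ! 1))) (cop h)
    = tev (\<lambda>ys. \<Sum>i<K. \<Sum>j<K. \<Sum>l<K. \<rho> (ys ! 1) i j * psum K Ts (\<lambda>xs. \<phi> (act (ys ! 0) (T l j) # xs)) i l) (cop h)"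
    by (simp add: tev_Tr_sigma psum_snoc sum_distrib_left)
  also have "\<dots> = tev (\<lambda>ys. \<Sum>i<K. \<Sum>l<K. psum K Ts (\<lambda>xs. \<Sum>j<K. \<rho> (ys ! 1) i j * \<phi> (act (ys ! 0) (T l j) # xs)) i l) (cop h)"
    by (simp only: psum_sum psum_scale) (subst (2) sum.swap, simp)
  also have "\<dots> = (\<Sum>i<K. \<Sum>l<K. tev (\<lambda>ys. psum K Ts (\<lambda>xs. \<Sum>j<K. \<rho> (ys ! 1) i j * \<phi> (act (ys ! 0) (T l j) # xs)) i l) (cop h))"
    by (simp only: tev_sum)
  also have "\<dots> = (\<Sum>i<K. \<Sum>l<K. psum K Ts (\<lambda>xs. tev (\<lambda>ys. \<Sum>j<K. \<rho> (ys ! 1) i j * \<phi> (act (ys ! 0) (T l j) # xs)) (cop h)) i l)"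
    by (simp only: psum_tev)
  also have "\<dots> = (\<Sum>i<K. \<Sum>l<K. psum K Ts (\<lambda>xs. \<Sum>k<K. \<rho> h k l * \<phi> (T k i # xs)) i l)"
    using eqvD[OF T \<phi>] by (intro sum.cong refl psum_cong) auto
  also have "\<dots> = (\<Sum>k<K. \<Sum>l<K. \<Sum>i<K. \<rho> h k l * psum K Ts (\<lambda>xs. \<phi> (T k i # xs)) i l)"
    by (simp only: psum_sum psum_scale) (rule sum_swap3)
  also have "\<dots> = tev \<phi> (Tr_sigma K \<rho> (T # Ts) h)"
    by (simp add: tev_Tr_sigma sum_distrib_left)
  finally show ?thesis .
qed

lemma tev_lam_Tr:
  assumes "eqv K \<rho> K \<rho> T" "multilin ofA (Suc (length Ts)) \<phi>"
  shows "tev \<phi> (lam cop act n (Tr_sigma K \<rho> (Ts @ [T])) h) = (-1) ^ n * tev \<phi> (Tr_sigma K \<rho> (T # Ts) h)"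
  using tev_Tr_rotate[OF assms(1) multilin_hd[OF assms(2)]] by (simp add: lam_def)

lemma tev_face_inner:
  assumes "\<And>i j. i < K \<Longrightarrow> j < K \<Longrightarrow> (\<Sum>k<K. X i k * Y k j) = Z i j"
    and "multilin ofA (Suc (length As + length Bs)) \<phi>" and "length As < n"
  shows "tev \<phi> (face cop act n (length As) (Tr_sigma K \<rho> (As @ X # Y # Bs)) h)
    = tev \<phi> (Tr_sigma K \<rho> (As @ Z # Bs) h)"
  using assms(3) psum_merge[OF assms(1,2)] by (simp add: face_def tev_Tr_sigma)

text \<open>The last face is the unsigned rotation followed by merging the first two slots.\<close>

lemma tev_face_last:
  assumes T: "eqv K \<rho> K \<rho> T" and Z: "\<And>i j. i < K \<Longrightarrow> j < K \<Longrightarrow> (\<Sum>k<K. T i k * X k j) = Z i j"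
    and \<phi>: "multilin ofA (Suc (length Us)) \<phi>"
  shows "tev \<phi> (face cop act n n (Tr_sigma K \<rho> (X # Us @ [T])) h) = tev \<phi> (Tr_sigma K \<rho> (Z # Us) h)"
proof -
  have "tev \<phi> (face cop act n n (Tr_sigma K \<rho> (X # Us @ [T])) h)
    = tev (\<lambda>ys. tev (\<lambda>as. \<phi> (act (ys ! 0) (last as) * hd as # butlast (tl as))) (Tr_sigma K \<rho> (X # Us @ [T]) (ys ! 1))) (cop h)"
    by (simp add: face_def)
  also have "\<dots> = tev (\<lambda>ys. tev (\<lambda>as. \<phi> (merge_at 0 (act (ys ! 0) (last as) # butlast as))) (Tr_sigma K \<rho> ((X # Us) @ [T]) (ys ! 1))) (cop h)"
    unfolding append_Cons
    by (intro tev_cong[OF wf_cop] tev_cong[OF wf_Tr_sigma]) (auto simp: length_Suc_conv merge_at_def)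
  also have "\<dots> = tev (\<lambda>as. \<phi> (merge_at 0 as)) (Tr_sigma K \<rho> (T # X # Us) h)"
    using clin_mult_right[OF multilin_hd[OF \<phi>]]
    by (intro tev_Tr_rotate[OF T]) (auto simp: length_Suc_conv merge_at_def)
  also have "\<dots> = tev \<phi> (Tr_sigma K \<rho> (Z # Us) h)"
    using psum_merge[of K T X Z ofA "[]" Us \<phi>, OF Z] \<phi> by (simp add: tev_Tr_sigma del: psum.simps)
  finally show ?thesis .
qed

lemma tev_bnd:
  "tev \<phi> (bnd cop act n \<omega> h) = (\<Sum>i<Suc n. (-1) ^ i * tev \<phi> (face cop act n i \<omega> h))"
proof -
  have "tev \<phi> (concat (map f is)) = sum_list (map (\<lambda>i. tev \<phi> (f i)) is)" for f and "is" :: "nat list"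
    by (induction "is") auto
  then show ?thesis
    by (simp add: bnd_def interv_sum_list_conv_sum_set_nat atLeast0LessThan del: upt_Suc)
qed

text \<open>Every inner face merges X P = X or P P = P and so gives the same chain; only the last
  face sees P X. A separate \<open>Z\<close> covers both X = P, where Z = P, and X = d, where Z =
  0.\<close>

lemma tev_bnd_Tr:
  assumes P: "eqv K \<rho> K \<rho> P"
    and PP: "\<And>i j. i < K \<Longrightarrow> j < K \<Longrightarrow> (\<Sum>k<K. P i k * P k j) = P i j"
    and XP: "\<And>i j. i < K \<Longrightarrow> j < K \<Longrightarrow> (\<Sum>k<K. X i k * P k j) = X i j"
    and PX: "\<And>i j. i < K \<Longrightarrow> j < K \<Longrightarrow> (\<Sum>k<K. P i k * X k j) = Z i j"
    and \<phi>: "multilin ofA (Suc n) \<phi>"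
  shows "tev \<phi> (bnd cop act (Suc n) (Tr_sigma K \<rho> (X # replicate (Suc n) P)) h)
    = (\<Sum>i<Suc n. (-1) ^ i) * tev \<phi> (Tr_sigma K \<rho> (X # replicate n P) h)
      - (-1) ^ n * tev \<phi> (Tr_sigma K \<rho> (Z # replicate n P) h)"
proof -
  have inner: "tev \<phi> (face cop act (Suc n) i (Tr_sigma K \<rho> (X # replicate (Suc n) P)) h)
      = tev \<phi> (Tr_sigma K \<rho> (X # replicate n P) h)" if "i < Suc n" for i
  proof (cases i)
    case 0
    then show ?thesis using tev_face_inner[of K X P X "[]" "replicate n P" \<phi> "Suc n" \<rho> h, OF XP] \<phi>
      by simp
  next
    case (Suc k)
    then obtain l where n: "n = Suc (k + l)" using \<open>i < Suc n\<close> less_iff_Suc_add by auto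
    have r: "replicate k P @ P # replicate l P = replicate n P"
      "replicate k P @ P # P # replicate l P = replicate (Suc n) P"
      using replicate_add[of k "Suc l" P] replicate_add[of k "Suc (Suc l)" P] by (simp_all add: n)
    show ?thesis
      using tev_face_inner[of K P P P "X # replicate k P" "replicate l P" \<phi> "Suc n" \<rho> h, OF PP] \<phi> n Suc
      by (simp add: r del: replicate.simps)
  qed
  have "tev \<phi> (face cop act (Suc n) (Suc n) (Tr_sigma K \<rho> (X # replicate n P @ [P])) h)
      = tev \<phi> (Tr_sigma K \<rho> (Z # replicate n P) h)"
    using \<phi> by (intro tev_face_last[OF P PX]) auto
  then show ?thesis
    unfolding tev_bnd sum.lessThan_Suc[of _ "Suc n"]
    by (simp only: replicate_append_same replicate_Suc[symmetric])
      (simp add: inner sum_distrib_right del: sum.lessThan_Suc replicate.simps)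
qed

end

section \<open>Exact integration of polynomials by a quadrature formula\<close>

lemma poly_antiderivative: "\<exists>A. pderiv A = (L :: complex poly)"
proof
  show "pderiv (\<Sum>k\<le>degree L. monom (coeff L k / of_nat (Suc k)) (Suc k)) = L"
    by (simp add: higher_pderiv_sum[of 1, simplified] pderiv_monom poly_as_sum_of_monoms field_simps
        del: of_nat_Suc)
qed

text \<open>Lagrange interpolation at 0, ..., n reproduces polynomials of degree at most n, so the
  weights are the integrals over [0, 1] of the Lagrange basis polynomials
  \<open>L i\<close>.\<close>

lemma quadrature:
  "\<exists>w. \<forall>P :: complex poly. degree P \<le> Suc n \<longrightarrow>
     poly P 1 - poly P 0 = (\<Sum>i<Suc n. w i * poly (pderiv P) (of_nat i))"
proof -
  define D where "D i = (\<Prod>j\<in>{..<Suc n} - {i}. of_nat i - of_nat j :: complex)" for i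
  define L where "L i = smult (1 / D i) (\<Prod>j\<in>{..<Suc n} - {i}. [:- of_nat j, 1:] :: complex poly)" for i
  have D: "D i \<noteq> 0" for i by (simp add: D_def)
  have L: "poly (L i) (of_nat k) = (if k = i then 1 else 0)" if "k < Suc n" for i k
    using D[of i] that by (auto simp: L_def poly_prod D_def)
  have degL: "degree (L i) \<le> n" if "i < Suc n" for i
  proof -
    have "degree (\<Prod>j\<in>{..<Suc n} - {i}. [:- of_nat j, 1:] :: complex poly)
      \<le> sum (degree \<circ> (\<lambda>j. [:- of_nat j, 1:] :: complex poly)) ({..<Suc n} - {i})"
      by (rule degree_prod_sum_le) simp
    also have "\<dots> = n" using that by (simp add: card_Diff_singleton_if)
    finally show ?thesis by (simp add: L_def D)
  qed
  have interp: "Q = (\<Sum>i<Suc n. smult (poly Q (of_nat i)) (L i))" (is "Q = ?R") if "degree Q \<le> n" for Q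
  proof (rule poly_eqI_degree[where A = "of_nat ` {..<Suc n}"])
    have card: "card (of_nat ` {..<Suc n} :: complex set) = Suc n"
      by (subst card_image) (auto simp: inj_on_def)
    show "poly Q x = poly ?R x" if x: "x \<in> of_nat ` {..<Suc n}" for x
    proof -
      obtain k where k: "x = of_nat k" "k < Suc n" using x by auto
      then have "poly ?R x = (\<Sum>i<Suc n. poly Q (of_nat i) * (if k = i then 1 else 0))"
        by (simp add: poly_sum L del: sum.lessThan_Suc)
      also have "\<dots> = poly Q x" using k by (simp add: if_distrib sum.delta cong: if_cong del: sum.lessThan_Suc)
      finally show ?thesis by simp
    qed
    show "card (of_nat ` {..<Suc n} :: complex set) > degree Q" using card that by simp
    have "degree ?R \<le> n"
      by (rule degree_sum_le) (use degL degree_smult_le order_trans in \<open>auto simp del: sum.lessThan_Suc\<close>)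
    then show "card (of_nat ` {..<Suc n} :: complex set) > degree ?R" using card by simp
  qed
  obtain A where A: "\<And>i. pderiv (A i) = L i"
    using choice[of "\<lambda>i A. pderiv A = L i"] poly_antiderivative by blast
  show ?thesis
  proof (intro exI allI impI)
    fix P :: "complex poly" assume "degree P \<le> Suc n"
    then have deg: "degree (pderiv P) \<le> n" by (simp add: degree_pderiv)
    \<comment> \<open>\<open>P\<close> minus the antiderivative of its interpolated derivative has
      derivative 0 and is therefore constant.\<close>
    define R where "R = P - (\<Sum>i<Suc n. smult (poly (pderiv P) (of_nat i)) (A i))"
    have "pderiv R = 0"
      using interp[OF deg] by (simp add: R_def pderiv_diff higher_pderiv_sum[of 1, simplified] pderiv_smult A del: sum.lessThan_Suc)
    then have "poly R 1 = poly R 0"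
      by (metis pderiv_eq_0_iff degree_eq_zeroE poly_pCons mult_zero_right poly_0)
    then show "poly P 1 - poly P 0 = (\<Sum>i<Suc n. (poly (A i) 1 - poly (A i) 0) * poly (pderiv P) (of_nat i))"
      by (simp add: R_def poly_sum sum_subtractf algebra_simps del: sum.lessThan_Suc)
  qed
qed

text \<open>This is the product rule: the derivative along p + t d replaces one factor at a time by
  d. It is stated as an identity of polynomials so that \<open>quadrature\<close> applies.\<close>

lemma multilinear_path_poly:
  fixes \<Phi> :: "'m list \<Rightarrow> complex"
  assumes "\<And>as bs t. Suc (length as + length bs) = n \<Longrightarrow>
    \<Phi> (as @ pt t # bs) = \<Phi> (as @ p # bs) + t * \<Phi> (as @ d # bs)"
  shows "\<exists>P. degree P \<le> n \<and> (\<forall>t. poly P t = \<Phi> (replicate n (pt t))) \<and>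
    (\<forall>t. poly (pderiv P) t = (\<Sum>j<n. \<Phi> (replicate j (pt t) @ d # replicate (n - Suc j) (pt t))))"
  using assms
proof (induction n arbitrary: \<Phi>)
  case 0
  show ?case by (rule exI[of _ "[:\<Phi> []:]"]) simp
next
  case (Suc n)
  have "\<exists>P. degree P \<le> n \<and> (\<forall>t. poly P t = \<Phi> (x # replicate n (pt t))) \<and>
    (\<forall>t. poly (pderiv P) t = (\<Sum>j<n. \<Phi> (x # replicate j (pt t) @ d # replicate (n - Suc j) (pt t))))" for x
    by (rule Suc.IH) (use Suc.prems[of "x # _"] in simp)
  then obtain Q where Q: "degree (Q x) \<le> n" "poly (Q x) t = \<Phi> (x # replicate n (pt t))"
    "poly (pderiv (Q x)) t = (\<Sum>j<n. \<Phi> (x # replicate j (pt t) @ d # replicate (n - Suc j) (pt t)))" for x t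
    by metis
  have step: "\<Phi> (pt t # bs) = \<Phi> (p # bs) + t * \<Phi> (d # bs)" if "length bs = n" for bs t
    using Suc.prems[of "[]" bs] that by simp
  \<comment> \<open>Expanding the first entry as p + t d gives Q p + t Q d. In the derivative, the
    bare term Q d is the summand with \<open>d\<close> in position 0.\<close>
  let ?P = "Q p + pCons 0 (Q d)"
  have "degree ?P \<le> Suc n"
    using Q(1)[of p] Q(1)[of d] by (intro degree_add_le) (auto intro: order_trans[OF degree_pCons_le])
  moreover have "poly ?P t = \<Phi> (replicate (Suc n) (pt t))" for t
    by (simp add: Q(2) step)
  moreover have "poly (pderiv ?P) t =
      (\<Sum>j<Suc n. \<Phi> (replicate j (pt t) @ d # replicate (Suc n - Suc j) (pt t)))" for t
    unfolding sum.lessThan_Suc_shift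
    by (simp add: pderiv_add pderiv_pCons Q step sum.distrib sum_distrib_left)
  ultimately show ?case by blast
qed

section \<open>Block matrices\<close>

definition blk where
  "blk (N :: nat) a b c d = (\<lambda>i j. if i < N then (if j < N then a i j else b i (j - N))
     else (if j < N then c (i - N) j else d (i - N) (j - N)))"

lemma blk_simps [simp]:
  "i < N \<Longrightarrow> j < N \<Longrightarrow> blk N a b c d i j = a i j"
  "i < N \<Longrightarrow> blk N a b c d i (N + j) = b i j"
  "j < N \<Longrightarrow> blk N a b c d (N + i) j = c i j"
  "blk N a b c d (N + i) (N + j) = d i j"
  by (auto simp: blk_def)

lemma bdiag_eq_blk: "bdiag N X Y = blk N X (\<lambda>_ _. 0) (\<lambda>_ _. 0) Y"
  by (intro ext) (auto simp: bdiag_def blk_def)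

lemma sum_lessThan_add:
  "(\<Sum>k<N + M. g k) = (\<Sum>k<N. g k) + (\<Sum>k<M. g (N + k :: nat) :: 'b::comm_monoid_add)"
  by (induction M) (auto simp: add.assoc)

lemma less_add_cases:
  assumes "(i::nat) < N + M"
  obtains "i < N" | i' where "i' < M" "i = N + i'"
  using assms by (metis less_imp_add_positive nat_add_left_cancel_less not_less_iff_gr_or_eq add.right_neutral that)

text \<open>A path through a zero entry contributes nothing. With a zero lower left block no path
  returns from the second block to the first, so a path with both ends in one block stays there; the
  first conjunct carries the induction.\<close>

lemma psum_blk_upper:
  assumes "multilin ofA n \<phi>"
  shows "(\<forall>k j. j < N \<longrightarrow> psum (N + M) (replicate n (blk N a b (\<lambda>_ _. 0) d)) \<phi> (N + k) j = 0) \<and>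
    (\<forall>i j. i < N \<longrightarrow> j < N \<longrightarrow>
      psum (N + M) (replicate n (blk N a b (\<lambda>_ _. 0) d)) \<phi> i j = psum N (replicate n a) \<phi> i j) \<and>
    (\<forall>i j. psum (N + M) (replicate n (blk N a b (\<lambda>_ _. 0) d)) \<phi> (N + i) (N + j) = psum M (replicate n d) \<phi> i j)"
  using assms
proof (induction n arbitrary: \<phi>)
  case (Suc n)
  have "psum K (replicate n X) (\<lambda>xs. \<phi> (0 # xs)) i j = 0" for K X i j
    by (rule psum_zero_entry[where ofA = ofA]) (use Suc.prems in simp)
  then show ?case
    using Suc.IH[OF multilin_Cons[OF Suc.prems]] by (simp add: sum_lessThan_add)
qed auto

lemma psum_blk_lower:
  assumes "multilin ofA n \<phi>"
  shows "(\<forall>i j. i < N \<longrightarrow> psum (N + M) (replicate n (blk N a (\<lambda>_ _. 0) c d)) \<phi> i (N + j) = 0) \<and>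
    (\<forall>i j. i < N \<longrightarrow> j < N \<longrightarrow>
      psum (N + M) (replicate n (blk N a (\<lambda>_ _. 0) c d)) \<phi> i j = psum N (replicate n a) \<phi> i j) \<and>
    (\<forall>i j. psum (N + M) (replicate n (blk N a (\<lambda>_ _. 0) c d)) \<phi> (N + i) (N + j) = psum M (replicate n d) \<phi> i j)"
  using assms
proof (induction n arbitrary: \<phi>)
  case (Suc n)
  have "psum K (replicate n X) (\<lambda>xs. \<phi> (0 # xs)) i j = 0" for K X i j
    by (rule psum_zero_entry[where ofA = ofA]) (use Suc.prems in simp)
  then show ?case
    using Suc.IH[OF multilin_Cons[OF Suc.prems]] by (simp add: sum_lessThan_add)
qed auto

text \<open>Paths changing blocks once may survive, but their end points lie in different blocks,
  where the block diagonal representation vanishes. Hence the off-diagonal block is invisible to the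
  trace.\<close>

lemma tev_Tr_blk:
  assumes "multilin ofA n \<phi>" "b = (\<lambda>_ _. 0) \<or> c = (\<lambda>_ _. 0)"
  shows "tev \<phi> (Tr_sigma (N + M) (\<lambda>h. bdiag N (\<sigma> h) (\<tau> h)) (replicate n (blk N a b c d)) h)
    = tev \<phi> (Tr_sigma N \<sigma> (replicate n a) h) + tev \<phi> (Tr_sigma M \<tau> (replicate n d) h)"
  using assms(2) psum_blk_upper[OF assms(1)] psum_blk_lower[OF assms(1)]
  by (auto simp: tev_Tr_sigma sum_lessThan_add bdiag_eq_blk)

lemma tev_Tr_zero:
  assumes "multilin ofA (Suc (length Ts)) \<phi>"
  shows "tev \<phi> (Tr_sigma K \<rho> ((\<lambda>_ _. 0) # Ts) h) = 0"
  using psum_zero_entry[OF assms] by (simp add: tev_Tr_sigma)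

context hopf_module_algebra
begin

lemma eqv_blk:
  assumes "eqv N \<sigma> N \<sigma> a" "eqv N \<sigma> M \<tau> b" "eqv M \<tau> N \<sigma> c" "eqv M \<tau> M \<tau> d"
  shows "eqv (N + M) (\<lambda>h. bdiag N (\<sigma> h) (\<tau> h)) (N + M) (\<lambda>h. bdiag N (\<sigma> h) (\<tau> h)) (blk N a b c d)"
  unfolding eqv_def bdiag_eq_blk
proof (intro allI impI)
  fix L h i m assume L: "clin ofA L" and i: "i < N + M" and m: "m < N + M"
  note e = assms[THEN eqvD, OF L]
  show "tev (\<lambda>ys. \<Sum>j<N + M. blk N (\<sigma> (ys ! 1)) (\<lambda>_ _. 0) (\<lambda>_ _. 0) (\<tau> (ys ! 1)) m j *
         L (act (ys ! 0) (blk N a b c d i j))) (cop h)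
       = (\<Sum>k<N + M. blk N (\<sigma> h) (\<lambda>_ _. 0) (\<lambda>_ _. 0) (\<tau> h) k i * L (blk N a b c d k m))"
    by (rule less_add_cases[OF i]; rule less_add_cases[OF m])
      (simp_all add: sum_lessThan_add e del: One_nat_def)
qed

lemma rep_bdiag:
  assumes "rep N \<sigma>" "rep M \<tau>"
  shows "rep (N + M) (\<lambda>h. bdiag N (\<sigma> h) (\<tau> h))"
  unfolding rep_def bdiag_eq_blk
proof (intro allI impI)
  fix i j assume i: "i < N + M" and j: "j < N + M"
  show "clin ofU (\<lambda>h. blk N (\<sigma> h) (\<lambda>_ _. 0) (\<lambda>_ _. 0) (\<tau> h) i j) \<and>
    (\<forall>g h. blk N (\<sigma> (g * h)) (\<lambda>_ _. 0) (\<lambda>_ _. 0) (\<tau> (g * h)) i j =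
      (\<Sum>k<N + M. blk N (\<sigma> g) (\<lambda>_ _. 0) (\<lambda>_ _. 0) (\<tau> g) i k * blk N (\<sigma> h) (\<lambda>_ _. 0) (\<lambda>_ _. 0) (\<tau> h) k j))"
    by (rule less_add_cases[OF i]; rule less_add_cases[OF j])
      (simp_all add: sum_lessThan_add assms[unfolded rep_def, rule_format] clin_const_0)
qed

section \<open>Null-homologous chains\<close>

text \<open>\<open>cyc_homologous\<close> is this predicate at a difference. Having a single
  argument, it can be closed under finite linear combinations.\<close>

definition null :: "nat \<Rightarrow> ('u, 'a) cochain \<Rightarrow> bool" where
  "null n \<omega> \<longleftrightarrow> (\<exists>\<eta> \<theta>. chain ofU cop ofA act (Suc n) \<eta> \<and> chain ofU cop ofA act n \<theta> \<and>
     ceq ofA n \<omega> (cadd (bnd cop act (Suc n) \<eta>) (csub \<theta> (lam cop act n \<theta>))))"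

lemma chain_iff:
  "chain ofU cop ofA act n \<omega> \<longleftrightarrow> (\<forall>h. wf_ten (Suc n) (\<omega> h)) \<and>
    (\<forall>\<phi>. multilin ofA (Suc n) \<phi> \<longrightarrow> clin ofU (\<lambda>h. tev \<phi> (\<omega> h)) \<and>
      (\<forall>h x. tev (\<lambda>ys. tev (\<lambda>hs. tev (\<lambda>as. \<phi> (map2 act hs as)) (\<omega> (x * ys ! 1))) (copn cop n (ys ! 0))) (cop h)
         = tev \<phi> (\<omega> (h * x))))"
  unfolding chain_def teq_def clin_def tact_def tev_tbind tev_append tev_tscale tev_single by blast

lemma ceq_iff: "ceq ofA n \<omega> \<eta> \<longleftrightarrow> (\<forall>h \<phi>. multilin ofA (Suc n) \<phi> \<longrightarrow> tev \<phi> (\<omega> h) = tev \<phi> (\<eta> h))"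
  by (simp add: ceq_def teq_def)

lemma chain_zero: "chain ofU cop ofA act n (\<lambda>h. [])"
  by (simp add: chain_iff wf_ten_def clin_const_0)

lemma chain_axpy:
  assumes "chain ofU cop ofA act n \<omega>" "chain ofU cop ofA act n \<eta>"
  shows "chain ofU cop ofA act n (cadd \<omega> (\<lambda>h. tscale c (\<eta> h)))"
  unfolding chain_iff
proof (intro conjI allI impI)
  show "wf_ten (Suc n) (cadd \<omega> (\<lambda>h. tscale c (\<eta> h)) h)" for h
    using assms by (fastforce simp: chain_iff cadd_def wf_ten_def tscale_def)
next
  fix \<phi> :: "'a list \<Rightarrow> complex" assume \<phi>: "multilin ofA (Suc n) \<phi>"
  note chainD = assms[unfolded chain_iff, THEN conjunct2, rule_format, OF \<phi>]
  show "clin ofU (\<lambda>h. tev \<phi> (cadd \<omega> (\<lambda>h. tscale c (\<eta> h)) h))"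
    unfolding cadd_def tev_append tev_tscale
    using chainD by (intro clin_plus clin_scale) auto
  show "tev (\<lambda>ys. tev (\<lambda>hs. tev (\<lambda>as. \<phi> (map2 act hs as)) (cadd \<omega> (\<lambda>h. tscale c (\<eta> h)) (x * ys ! 1)))
      (copn cop n (ys ! 0))) (cop h) = tev \<phi> (cadd \<omega> (\<lambda>h. tscale c (\<eta> h)) (h * x))" for h x
    unfolding cadd_def tev_append tev_tscale tev_add tev_scale
    using chainD by metis
qed

lemma tev_face:
  "tev \<phi> (face cop act n i \<omega> h) = (if i < n then tev (\<lambda>as. \<phi> (merge_at i as)) (\<omega> h)
     else tev (\<lambda>ys. tev (\<lambda>as. \<phi> ((act (ys!0) (last as) * hd as) # butlast (tl as))) (\<omega> (ys!1))) (cop h))"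
  by (simp add: face_def)

lemma tev_bnd_axpy:
  "tev \<phi> (bnd cop act n (cadd \<omega> (\<lambda>h. tscale c (\<eta> h))) h)
    = tev \<phi> (bnd cop act n \<omega> h) + c * tev \<phi> (bnd cop act n \<eta> h)"
proof -
  have "tev \<phi> (face cop act n i (cadd \<omega> (\<lambda>h. tscale c (\<eta> h))) h)
    = tev \<phi> (face cop act n i \<omega> h) + c * tev \<phi> (face cop act n i \<eta> h)" for i
    by (simp add: tev_face cadd_def tev_add tev_scale)
  then show ?thesis
    by (simp add: tev_bnd distrib_left sum.distrib sum_distrib_left mult.left_commute del: sum.lessThan_Suc)
qed

lemma tev_lam_axpy:
  "tev \<phi> (lam cop act n (cadd \<omega> (\<lambda>h. tscale c (\<eta> h))) h)
    = tev \<phi> (lam cop act n \<omega> h) + c * tev \<phi> (lam cop act n \<eta> h)"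
  by (simp add: lam_def cadd_def tev_add tev_scale algebra_simps)

lemma tev_bnd_zero: "tev \<phi> (bnd cop act n (\<lambda>h. []) h) = 0"
  by (simp add: tev_bnd tev_face)

lemma tev_lam_zero: "tev \<phi> (lam cop act n (\<lambda>h. []) h) = 0"
  by (simp add: lam_def)

lemma null_cong: "null n \<omega> \<Longrightarrow> ceq ofA n \<omega>' \<omega> \<Longrightarrow> null n \<omega>'"
  unfolding null_def ceq_iff by metis

lemma null_axpy:
  assumes "null n \<omega>" "null n \<omega>'"
  shows "null n (cadd \<omega> (\<lambda>h. tscale c (\<omega>' h)))"
proof -
  from assms obtain \<eta> \<theta> \<eta>' \<theta>' where
    "chain ofU cop ofA act (Suc n) \<eta>" "chain ofU cop ofA act n \<theta>"
    "ceq ofA n \<omega> (cadd (bnd cop act (Suc n) \<eta>) (csub \<theta> (lam cop act n \<theta>)))"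
    "chain ofU cop ofA act (Suc n) \<eta>'" "chain ofU cop ofA act n \<theta>'"
    "ceq ofA n \<omega>' (cadd (bnd cop act (Suc n) \<eta>') (csub \<theta>' (lam cop act n \<theta>')))"
    unfolding null_def by blast
  note * = this
  show ?thesis unfolding null_def
  proof (intro exI conjI)
    show "chain ofU cop ofA act (Suc n) (cadd \<eta> (\<lambda>h. tscale c (\<eta>' h)))"
      "chain ofU cop ofA act n (cadd \<theta> (\<lambda>h. tscale c (\<theta>' h)))"
      by (rule chain_axpy[OF *(1,4)], rule chain_axpy[OF *(2,5)])
    show "ceq ofA n (cadd \<omega> (\<lambda>h. tscale c (\<omega>' h)))
      (cadd (bnd cop act (Suc n) (cadd \<eta> (\<lambda>h. tscale c (\<eta>' h))))
        (csub (cadd \<theta> (\<lambda>h. tscale c (\<theta>' h))) (lam cop act n (cadd \<theta> (\<lambda>h. tscale c (\<theta>' h))))))"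
      unfolding ceq_iff
    proof (intro allI impI)
      fix h \<phi> assume \<phi>: "multilin ofA (Suc n) \<phi>"
      show "tev \<phi> (cadd \<omega> (\<lambda>h. tscale c (\<omega>' h)) h) =
        tev \<phi> (cadd (bnd cop act (Suc n) (cadd \<eta> (\<lambda>h. tscale c (\<eta>' h))))
        (csub (cadd \<theta> (\<lambda>h. tscale c (\<theta>' h))) (lam cop act n (cadd \<theta> (\<lambda>h. tscale c (\<theta>' h))))) h)"
        unfolding cadd_def[of "bnd _ _ _ _"] csub_def tev_append tev_tscale tev_bnd_axpy tev_lam_axpy
        unfolding cadd_def tev_append tev_tscale
          *(3)[unfolded ceq_iff, rule_format, OF \<phi>] *(6)[unfolded ceq_iff, rule_format, OF \<phi>] csub_def
        by (simp add: algebra_simps)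
    qed
  qed
qed

lemma null_Im:
  assumes "chain ofU cop ofA act n \<theta>"
  shows "null n (csub \<theta> (lam cop act n \<theta>))"
  unfolding null_def
  by (intro exI[of _ "\<lambda>h. []"] exI[of _ \<theta>]) (simp add: assms chain_zero ceq_iff cadd_def tev_bnd_zero)

lemma null_bnd:
  assumes "chain ofU cop ofA act (Suc n) \<eta>"
  shows "null n (bnd cop act (Suc n) \<eta>)"
  unfolding null_def
  by (intro exI[of _ "\<eta>"] exI[of _ "\<lambda>h. []"])
    (simp add: assms chain_zero ceq_iff cadd_def csub_def tev_lam_zero)

lemma null_zero: "null n (\<lambda>h. [])"
  by (rule null_cong[OF null_Im[OF chain_zero]]) (simp add: ceq_iff csub_def tev_lam_zero)

text \<open>Only values under functionals are compared, so an identity of numbers such as a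
  quadrature formula can be fed in directly.\<close>

lemma null_sum:
  assumes "\<And>i. i < (m::nat) \<Longrightarrow> null n (\<omega> i)"
    and "\<And>h \<phi>. multilin ofA (Suc n) \<phi> \<Longrightarrow> tev \<phi> (\<psi> h) = (\<Sum>i<m. w i * tev \<phi> (\<omega> i h))"
  shows "null n \<psi>"
  using assms
proof (induction m arbitrary: \<psi>)
  case 0
  show ?case by (rule null_cong[OF null_zero]) (use 0 in \<open>simp add: ceq_iff\<close>)
next
  case (Suc m)
  have "null n (cadd \<psi> (\<lambda>h. tscale (- w m) (\<omega> m h)))"
    by (rule Suc.IH) (use Suc.prems in \<open>auto simp: cadd_def\<close>)
  then have "null n (cadd (cadd \<psi> (\<lambda>h. tscale (- w m) (\<omega> m h))) (\<lambda>h. tscale (w m) (\<omega> m h)))"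
    by (rule null_axpy) (use Suc.prems in auto)
  then show ?case
    by (rule null_cong) (simp add: ceq_iff cadd_def)
qed

lemma null_diff:
  assumes "null n \<omega>" "null n \<eta>"
  shows "null n (csub \<omega> \<eta>)"
  using null_axpy[OF assms, of "-1"] by (simp add: csub_def cadd_def)

end

lemma alternating_sum: "(\<Sum>i<Suc n. (-1) ^ i) = (if even n then 1 else 0 :: complex)"
  by (induction n) auto

context hopf_module_algebra
begin

section \<open>Homotopy invariance\<close>

text \<open>Position 0 is a boundary: the face coefficient is 1 because \<open>n\<close> is even,
  and the last face vanishes by P d = 0. Each further position differs from the previous one by an
  element of the image of 1 - \<lambda>.\<close>

lemma null_commutator:
  assumes n: "even n" and \<rho>: "rep K \<rho>" and P: "eqv K \<rho> K \<rho> P" and d: "eqv K \<rho> K \<rho> d"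
    and PP: "\<And>i j. i < K \<Longrightarrow> j < K \<Longrightarrow> (\<Sum>k<K. P i k * P k j) = P i j"
    and dP: "\<And>i j. i < K \<Longrightarrow> j < K \<Longrightarrow> (\<Sum>k<K. d i k * P k j) = d i j"
    and Pd: "\<And>i j. i < K \<Longrightarrow> j < K \<Longrightarrow> (\<Sum>k<K. P i k * d k j) = 0"
    and "j \<le> n"
  shows "null n (Tr_sigma K \<rho> (replicate j P @ d # replicate (n - j) P))"
  using \<open>j \<le> n\<close>
proof (induction j)
  case 0
  have "chain ofU cop ofA act (Suc n) (Tr_sigma K \<rho> (d # replicate (Suc n) P))"
    using P d by (intro chain_Tr_sigma[OF \<rho>]) auto
  then have "null n (bnd cop act (Suc n) (Tr_sigma K \<rho> (d # replicate (Suc n) P)))"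
    by (rule null_bnd)
  then show ?case
  proof (rule null_cong, unfold ceq_iff, intro allI impI)
    fix h :: 'u and \<phi> :: "'a list \<Rightarrow> complex" assume \<phi>: "multilin ofA (Suc n) \<phi>"
    have "tev \<phi> (Tr_sigma K \<rho> ((\<lambda>_ _. 0) # replicate n P) h) = 0"
      by (rule tev_Tr_zero[where ofA = ofA]) (use \<phi> in simp)
    with tev_bnd_Tr[OF P PP dP Pd \<phi>, of h] n
    show "tev \<phi> (Tr_sigma K \<rho> (replicate 0 P @ d # replicate (n - 0) P) h)
      = tev \<phi> (bnd cop act (Suc n) (Tr_sigma K \<rho> (d # replicate (Suc n) P)) h)"
      by (simp add: alternating_sum del: sum.lessThan_Suc replicate_Suc)
  qed
next
  case (Suc j)
  let ?X = "\<lambda>j. Tr_sigma K \<rho> (replicate j P @ d # replicate (n - j) P)"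
  have X: "chain ofU cop ofA act n (?X j)"
    using P d Suc.prems by (intro chain_Tr_sigma[OF \<rho>]) auto
  \<comment> \<open>Since n is even, \<lambda> rotates without a sign, so X_(j+1) = \<lambda> X_j =
    X_j - (1 - \<lambda>) X_j.\<close>
  have "null n (cadd (?X j) (\<lambda>h. tscale (-1) (csub (?X j) (lam cop act n (?X j)) h)))"
    by (rule null_axpy[OF _ null_Im[OF X]]) (use Suc in simp)
  then show ?case
  proof (rule null_cong, unfold ceq_iff, intro allI impI)
    fix h :: 'u and \<phi> :: "'a list \<Rightarrow> complex" assume \<phi>: "multilin ofA (Suc n) \<phi>"
    obtain m where m: "n - j = Suc m" "n - Suc j = m" using Suc.prems by (metis Suc_diff_Suc Suc_le_lessD)
    have len: "length (replicate j P @ d # replicate m P) = n" using m Suc.prems by simp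
    have "tev \<phi> (lam cop act n (Tr_sigma K \<rho> ((replicate j P @ d # replicate m P) @ [P])) h)
      = tev \<phi> (Tr_sigma K \<rho> (P # replicate j P @ d # replicate m P) h)"
      using tev_lam_Tr[OF P, of "replicate j P @ d # replicate m P" \<phi> n h] \<phi> n by (simp only: len) simp
    then show "tev \<phi> (?X (Suc j) h)
      = tev \<phi> (cadd (?X j) (\<lambda>h. tscale (-1) (csub (?X j) (lam cop act n (?X j)) h)) h)"
      by (simp add: cadd_def csub_def m replicate_append_same)
  qed
qed

text \<open>\<open>E\<close> and \<open>F\<close> have the same kernel, so the straight line \<open>E + t (F - E)\<close> between them consists of
  idempotents. The derivative along it is null-homologous at every \<open>t\<close>, and a quadrature formula
  turns the integral over \<open>t\<close> into a finite linear combination.\<close>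

lemma homologous_same_kernel:
  assumes n: "even n" and \<rho>: "rep K \<rho>" and E: "eqv K \<rho> K \<rho> E" and F: "eqv K \<rho> K \<rho> F"
    and EE: "\<And>i j. i < K \<Longrightarrow> j < K \<Longrightarrow> (\<Sum>k<K. E i k * E k j) = E i j"
    and EF: "\<And>i j. i < K \<Longrightarrow> j < K \<Longrightarrow> (\<Sum>k<K. E i k * F k j) = E i j"
    and FE: "\<And>i j. i < K \<Longrightarrow> j < K \<Longrightarrow> (\<Sum>k<K. F i k * E k j) = F i j"
    and FF: "\<And>i j. i < K \<Longrightarrow> j < K \<Longrightarrow> (\<Sum>k<K. F i k * F k j) = F i j"
  shows "null n (csub (Tr_sigma K \<rho> (replicate (Suc n) F)) (Tr_sigma K \<rho> (replicate (Suc n) E)))"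
proof -
  define d where "d = (\<lambda>i j. F i j - E i j)"
  define p where "p t = (\<lambda>i j. E i j + ofA t * d i j)" for t
  have neg: "ofA (-1) = -1" using ofA_add[of 1 "-1"] by (simp add: ofA_0 ofA_1 eq_neg_iff_add_eq_0 add.commute)
  have "d = (\<lambda>i j. F i j + ofA (-1) * E i j)" by (simp add: d_def neg)
  then have d: "eqv K \<rho> K \<rho> d" using eqv_lincomb[OF F E] by simp
  have p: "eqv K \<rho> K \<rho> (p t)" for t unfolding p_def by (rule eqv_lincomb[OF E d])
  have c: "E i k * (ofA t * x) = ofA t * (E i k * x)" "d i k * (ofA t * x) = ofA t * (d i k * x)" for i k x t
    by (metis mult.assoc ofA_comm)+
  \<comment> \<open>With d E = d, E d = 0 and d d = 0, the square of E + t d is E + t d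
    again.\<close>
  have dE: "(\<Sum>k<K. d i k * E k j) = d i j" and dd: "(\<Sum>k<K. d i k * d k j) = 0"
    and Ed: "(\<Sum>k<K. E i k * d k j) = 0" if "i < K" "j < K" for i j
    using EE EF FE FF that by (simp_all add: d_def left_diff_distrib right_diff_distrib sum_subtractf)
  have dp: "(\<Sum>k<K. d i k * p t k j) = d i j" and pd: "(\<Sum>k<K. p t i k * d k j) = 0"
    and pp: "(\<Sum>k<K. p t i k * p t k j) = p t i j" if "i < K" "j < K" for i j t
    using that EE
    by (simp_all add: p_def distrib_left distrib_right sum.distrib mult.assoc c
        sum_distrib_left[symmetric] dE dd Ed)
  have X: "null n (Tr_sigma K \<rho> (replicate j (p t) @ d # replicate (n - j) (p t)))" if "j < Suc n" for j t
    using that by (intro null_commutator[OF n \<rho> p d pp dp pd]) auto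
  \<comment> \<open>By the product rule, \<open>Y t\<close> is the derivative at t of the character
    of \<open>p t\<close>.\<close>
  define Y where "Y t h = concat (map (\<lambda>j. Tr_sigma K \<rho> (replicate j (p t) @ d # replicate (n - j) (p t)) h) [0..<Suc n])"
    for t h
  have tevY: "tev \<phi> (Y t h) = (\<Sum>j<Suc n. tev \<phi> (Tr_sigma K \<rho> (replicate j (p t) @ d # replicate (n - j) (p t)) h))"
    for \<phi> t h
  proof -
    have "tev \<phi> (concat (map f [0..<m])) = (\<Sum>j<m. tev \<phi> (f j))" for f and m
      by (induction m) auto
    then show ?thesis by (simp add: Y_def del: upt_Suc sum.lessThan_Suc)
  qed
  have Y: "null n (Y t)" for t
    by (rule null_sum[where w = "\<lambda>_. 1" and m = "Suc n", OF X]) (simp_all add: tevY del: sum.lessThan_Suc)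
  obtain w where w: "\<And>P :: complex poly. degree P \<le> Suc n \<Longrightarrow>
     poly P 1 - poly P 0 = (\<Sum>i<Suc n. w i * poly (pderiv P) (of_nat i))"
    using quadrature[of n] by blast
  show ?thesis
  proof (rule null_sum[where m = "Suc n" and w = w and \<omega> = "\<lambda>i. Y (of_nat i)", OF Y])
    fix h and \<phi> :: "'a list \<Rightarrow> complex" assume \<phi>: "multilin ofA (Suc n) \<phi>"
    let ?\<Phi> = "\<lambda>Ts. tev \<phi> (Tr_sigma K \<rho> Ts h)"
    have "?\<Phi> (as @ p t # bs) = ?\<Phi> (as @ E # bs) + t * ?\<Phi> (as @ d # bs)"
      if "Suc (length as + length bs) = Suc n" for as bs t
      using psum_lincomb[of ofA as bs \<phi> K E t d] \<phi> that
      by (simp add: tev_Tr_sigma p_def distrib_left sum.distrib sum_distrib_left mult.left_commute)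
    from multilinear_path_poly[of "Suc n" ?\<Phi> p E d, OF this]
    obtain P where P: "degree P \<le> Suc n" "\<And>t. poly P t = ?\<Phi> (replicate (Suc n) (p t))"
      "\<And>t. poly (pderiv P) t = (\<Sum>j<Suc n. ?\<Phi> (replicate j (p t) @ d # replicate (Suc n - Suc j) (p t)))"
      by blast
    have "p 0 = E" "p 1 = F" by (simp_all add: p_def d_def ofA_0 ofA_1)
    then have "tev \<phi> (csub (Tr_sigma K \<rho> (replicate (Suc n) F)) (Tr_sigma K \<rho> (replicate (Suc n) E)) h)
      = poly P 1 - poly P 0"
      using P(2)[of 0] P(2)[of 1] by (simp add: csub_def del: replicate.simps)
    also have "\<dots> = (\<Sum>i<Suc n. w i * tev \<phi> (Y (of_nat i) h))"
      unfolding w[OF P(1)] P(3) tevY by simp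
    finally show "tev \<phi> (csub (Tr_sigma K \<rho> (replicate (Suc n) F)) (Tr_sigma K \<rho> (replicate (Suc n) E)) h)
      = (\<Sum>i<Suc n. w i * tev \<phi> (Y (of_nat i) h))" .
  qed
qed

lemma null_isomorphic:
  assumes n: "even n" and \<sigma>: "rep N \<sigma>" and \<tau>: "rep M \<tau>"
    and e: "eqv N \<sigma> N \<sigma> e" and f: "eqv M \<tau> M \<tau> f" and u: "eqv N \<sigma> M \<tau> u"
    and ee: "\<And>i j. i < N \<Longrightarrow> j < N \<Longrightarrow> (\<Sum>k<N. e i k * e k j) = e i j"
    and ff: "\<And>i j. i < M \<Longrightarrow> j < M \<Longrightarrow> (\<Sum>k<M. f i k * f k j) = f i j"
    and uv: "\<And>i j. i < N \<Longrightarrow> j < N \<Longrightarrow> (\<Sum>k<M. u i k * v k j) = e i j"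
    and vu: "\<And>i j. i < M \<Longrightarrow> j < M \<Longrightarrow> (\<Sum>k<N. v i k * u k j) = f i j"
    and ve: "\<And>i j. i < M \<Longrightarrow> j < N \<Longrightarrow> (\<Sum>k<N. v i k * e k j) = v i j"
    and fv: "\<And>i j. i < M \<Longrightarrow> j < N \<Longrightarrow> (\<Sum>k<M. f i k * v k j) = v i j"
    and eu: "\<And>i j. i < N \<Longrightarrow> j < M \<Longrightarrow> (\<Sum>k<N. e i k * u k j) = u i j"
    and uf: "\<And>i j. i < N \<Longrightarrow> j < M \<Longrightarrow> (\<Sum>k<M. u i k * f k j) = u i j"
  shows "null n (csub (chern n N e \<sigma>) (chern n M f \<tau>))"
proof -
  have v: "eqv M \<tau> N \<sigma> v" by (rule eqv_inverse[OF \<sigma> \<tau> e f u uv vu ve fv])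
  let ?\<rho> = "\<lambda>h. bdiag N (\<sigma> h) (\<tau> h)" and ?z = "\<lambda>_ _. 0"
  let ?E = "blk N e u ?z ?z" and ?F = "blk N ?z ?z v f"
  \<comment> \<open>\<open>homologous_same_kernel\<close> is used with its \<open>E\<close> and
    \<open>F\<close> exchanged, which gives the difference in the order of the goal.\<close>
  have "null n (csub (Tr_sigma (N + M) ?\<rho> (replicate (Suc n) ?E)) (Tr_sigma (N + M) ?\<rho> (replicate (Suc n) ?F)))"
  proof (rule homologous_same_kernel[OF n rep_bdiag[OF \<sigma> \<tau>]])
    show "eqv (N + M) ?\<rho> (N + M) ?\<rho> ?E" "eqv (N + M) ?\<rho> (N + M) ?\<rho> ?F"
      by (intro eqv_blk eqv_0 e f u v)+
    fix i j assume i: "i < N + M" and j: "j < N + M"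
    note * = sum_lessThan_add ee ff uv vu ve fv eu uf
    show "(\<Sum>k<N + M. ?E i k * ?E k j) = ?E i j"
      by (rule less_add_cases[OF i]; rule less_add_cases[OF j]) (simp_all add: *)
    show "(\<Sum>k<N + M. ?E i k * ?F k j) = ?E i j"
      by (rule less_add_cases[OF i]; rule less_add_cases[OF j]) (simp_all add: *)
    show "(\<Sum>k<N + M. ?F i k * ?E k j) = ?F i j"
      by (rule less_add_cases[OF i]; rule less_add_cases[OF j]) (simp_all add: *)
    show "(\<Sum>k<N + M. ?F i k * ?F k j) = ?F i j"
      by (rule less_add_cases[OF i]; rule less_add_cases[OF j]) (simp_all add: *)
  qed
  then show ?thesis
  proof (rule null_cong, unfold ceq_iff, intro allI impI)
    fix h :: 'u and \<phi> :: "'a list \<Rightarrow> complex" assume \<phi>: "multilin ofA (Suc n) \<phi>"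
    \<comment> \<open>The tensor has at least one factor, so a zero diagonal block has zero
      character.\<close>
    have "tev \<phi> (Tr_sigma K \<kappa> (replicate (Suc n) ?z) h) = 0" for K \<kappa>
      using tev_Tr_zero[of ofA "replicate n ?z" \<phi> K \<kappa> h] \<phi> by simp
    then show "tev \<phi> (csub (chern n N e \<sigma>) (chern n M f \<tau>) h) =
      tev \<phi> (csub (Tr_sigma (N + M) ?\<rho> (replicate (Suc n) ?E)) (Tr_sigma (N + M) ?\<rho> (replicate (Suc n) ?F)) h)"
      using tev_Tr_blk[OF \<phi>, of u ?z N M \<sigma> \<tau> e ?z h] tev_Tr_blk[OF \<phi>, of ?z v N M \<sigma> \<tau> ?z f h]
      by (simp add: csub_def chern_def del: replicate.simps)
  qed
qed


section \<open>Chern characters of equivariant idempotents\<close>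

lemma clin_uact:
  assumes L: "clin ofA L" and "i < N"
  shows "L (uact cop ofA act N \<sigma> h w i) = tev (\<lambda>ys. \<Sum>j<N. \<sigma> (ys ! 1) i j * L (act (ys ! 0) (w j))) (cop h)"
proof -
  have "L (a * ofA c) = c * L a" for c a
    using L by (auto simp: clin_def ofA_comm[symmetric])
  then show ?thesis
    using assms by (simp add: uact_def clin_sum_list[OF L] tev_def comp_def case_prod_unfold clin_sum[OF L]
        sum_distrib_left mult.assoc)
qed

text \<open>Read row by row, equivariance of e says that its rows transform among themselves by the
  transpose of \<sigma>(h). Agreement with the row below \<open>N\<close> suffices, so truncated
  rows are covered as well.\<close>

lemma equiv_idem_uact:
  assumes "equiv_idem ofU cop ofA act N e \<sigma>" "i < N" "j < N" "\<And>k. k < N \<Longrightarrow> w k = e i k"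
  shows "uact cop ofA act N \<sigma> h w j = (\<Sum>k<N. ofA (\<sigma> h k i) * e k j)"
  using assms by (simp add: equiv_idem_def uact_def)

lemma eqv_equiv_idem:
  assumes "equiv_idem ofU cop ofA act N e \<sigma>"
  shows "eqv N \<sigma> N \<sigma> e"
  unfolding eqv_def
proof (intro allI impI)
  fix L h i m assume L: "clin ofA L" and im: "i < N" "m < N"
  show "tev (\<lambda>ys. \<Sum>j<N. \<sigma> (ys ! 1) m j * L (act (ys ! 0) (e i j))) (cop h)
       = (\<Sum>k<N. \<sigma> h k i * L (e k m))"
    using clin_uact[OF L im(2), of \<sigma> h "e i"] equiv_idem_uact[OF assms im, of "e i"] L
    by (simp add: clin_sum[OF L] clin_def)
qed

lemma rep_equiv_idem: "equiv_idem ofU cop ofA act N e \<sigma> \<Longrightarrow> rep N \<sigma>"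
  by (auto simp: equiv_idem_def rep_def clin_def)

lemma chain_chern:
  assumes "equiv_idem ofU cop ofA act N e \<sigma>"
  shows "chain ofU cop ofA act n (chern n N e \<sigma>)"
  unfolding chern_def
  using eqv_equiv_idem[OF assms] by (intro chain_Tr_sigma[OF rep_equiv_idem[OF assms]]) auto

lemma in_im_lam_chern:
  assumes e: "equiv_idem ofU cop ofA act N e \<sigma>" and "odd n"
  shows "in_im_lam ofU cop ofA act n (chern n N e \<sigma>)"
  unfolding in_im_lam_def
proof (intro exI conjI)
  \<comment> \<open>The half is written as 0 + (1/2) ch, the form that \<open>chain_axpy\<close> and
    \<open>tev_lam_axpy\<close> handle.\<close>
  let ?\<eta> = "cadd (\<lambda>h. []) (\<lambda>h. tscale (1 / 2) (chern n N e \<sigma> h))"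
  show "chain ofU cop ofA act n ?\<eta>"
    by (intro chain_axpy chain_zero chain_chern[OF e])
  have "tev \<phi> (lam cop act n (chern n N e \<sigma>) h) = - tev \<phi> (chern n N e \<sigma> h)"
    if "multilin ofA (Suc n) \<phi>" for \<phi> h
    using tev_lam_Tr[OF eqv_equiv_idem[OF e], of "replicate n e" \<phi> n h] that \<open>odd n\<close>
    by (simp add: chern_def replicate_append_same)
  then show "ceq ofA n (chern n N e \<sigma>) (csub ?\<eta> (lam cop act n ?\<eta>))"
    by (simp add: ceq_iff csub_def tev_lam_axpy tev_lam_zero) (simp add: cadd_def)
qed

lemma cyc_cycle_chern:
  assumes e: "equiv_idem ofU cop ofA act N e \<sigma>"
  shows "cyc_cycle ofU cop ofA act n (chern n N e \<sigma>)"
proof (cases n)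
  case 0
  then show ?thesis by (simp add: cyc_cycle_def)
next
  case (Suc m)
  have ee: "(\<Sum>k<N. e i k * e k j) = e i j" if "i < N" "j < N" for i j
    using e that by (simp add: equiv_idem_def)
  \<comment> \<open>The inner faces contribute 1 for even m and 0 for odd m, the last face -(-1)^m.
    The total is 0 or 1, and in the latter case m is odd, so the remaining character lies in the
    image of 1 - \<lambda>.\<close>
  have b: "tev \<phi> (bnd cop act n (chern n N e \<sigma>) h) = (if even m then 0 else tev \<phi> (chern m N e \<sigma> h))"
    if "multilin ofA (Suc m) \<phi>" for \<phi> h
    using tev_bnd_Tr[OF eqv_equiv_idem[OF e] ee ee ee that, of h]
    by (simp add: chern_def Suc alternating_sum del: sum.lessThan_Suc)
  have "in_im_lam ofU cop ofA act m (bnd cop act n (chern n N e \<sigma>))"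
  proof (cases "even m")
    case True
    then show ?thesis unfolding in_im_lam_def
      by (intro exI[of _ "\<lambda>h. []"]) (simp add: chain_zero ceq_iff b csub_def tev_lam_zero)
  next
    case False
    then obtain \<eta> where "chain ofU cop ofA act m \<eta>" "ceq ofA m (chern m N e \<sigma>) (csub \<eta> (lam cop act m \<eta>))"
      using in_im_lam_chern[OF e] unfolding in_im_lam_def by blast
    then show ?thesis unfolding in_im_lam_def
      by (intro exI[of _ \<eta>]) (use False in \<open>simp add: ceq_iff b\<close>)
  qed
  then show ?thesis by (simp add: cyc_cycle_def Suc)
qed

lemma null_in_im_lam: "in_im_lam ofU cop ofA act n \<theta> \<Longrightarrow> null n \<theta>"
  unfolding in_im_lam_def using null_Im null_cong by blast

lemma cyc_homologous_iff_null:
  "cyc_homologous ofU cop ofA act n \<omega> \<omega>' \<longleftrightarrow> null n (csub \<omega> \<omega>')"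
  by (simp add: cyc_homologous_def null_def)

section \<open>From module isomorphisms to matrices, and the final invariance statements\<close>

lemma pmod_sum:
  assumes "\<And>k. k < K \<Longrightarrow> w k \<in> pmod N e"
  shows "(\<lambda>j. \<Sum>k<K. a k * w k j) \<in> pmod N e"
proof -
  have "(\<Sum>i<N. (\<Sum>k<K. a k * w k i) * e i j) = (\<Sum>k<K. a k * w k j)" if "j < N" for j
  proof -
    have "(\<Sum>i<N. (\<Sum>k<K. a k * w k i) * e i j) = (\<Sum>k<K. a k * (\<Sum>i<N. w k i * e i j))"
      by (simp add: sum_distrib_right sum_distrib_left mult.assoc) (rule sum.swap)
    then show ?thesis using assms that by (simp add: pmod_def)
  qed
  then show ?thesis using assms by (simp add: pmod_def)
qed

text \<open>The rows of u are the images of the rows of e, and the rows of v the preimages of the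
  rows of f. As w = w e on the module, A-linearity makes \<phi> right multiplication by u.\<close>

lemma isomorphism_matrices:
  assumes e: "equiv_idem ofU cop ofA act N e \<sigma>" and f: "equiv_idem ofU cop ofA act M f \<tau>"
    and iso: "mod_iso cop ofA act N e \<sigma> M f \<tau>"
  obtains u v where "eqv N \<sigma> M \<tau> u"
    and "\<And>i j. i < N \<Longrightarrow> j < N \<Longrightarrow> (\<Sum>k<M. u i k * v k j) = e i j"
    and "\<And>i j. i < M \<Longrightarrow> j < M \<Longrightarrow> (\<Sum>k<N. v i k * u k j) = f i j"
    and "\<And>i j. i < M \<Longrightarrow> j < N \<Longrightarrow> (\<Sum>k<N. v i k * e k j) = v i j"
    and "\<And>i j. i < M \<Longrightarrow> j < N \<Longrightarrow> (\<Sum>k<M. f i k * v k j) = v i j"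
    and "\<And>i j. i < N \<Longrightarrow> j < M \<Longrightarrow> (\<Sum>k<N. e i k * u k j) = u i j"
    and "\<And>i j. i < N \<Longrightarrow> j < M \<Longrightarrow> (\<Sum>k<M. u i k * f k j) = u i j"
proof -
  from iso obtain \<phi> where bij: "bij_betw \<phi> (pmod N e) (pmod M f)"
    and add: "\<And>w v. w \<in> pmod N e \<Longrightarrow> v \<in> pmod N e \<Longrightarrow> \<phi> (\<lambda>i. w i + v i) = (\<lambda>i. \<phi> w i + \<phi> v i)"
    and scale: "\<And>a w. w \<in> pmod N e \<Longrightarrow> \<phi> (\<lambda>i. a * w i) = (\<lambda>i. a * \<phi> w i)"
    and equi: "\<And>h w. w \<in> pmod N e \<Longrightarrow> \<phi> (uact cop ofA act N \<sigma> h w) = uact cop ofA act M \<tau> h (\<phi> w)"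
    unfolding mod_iso_def by blast
  have lin: "\<phi> (\<lambda>j. \<Sum>k<K. a k * w k j) = (\<lambda>j. \<Sum>k<K. a k * \<phi> (w k) j)"
    if "\<And>k. k < K \<Longrightarrow> w k \<in> pmod N e" for K :: nat and a w
    using that
  proof (induction K)
    case 0
    have "(\<lambda>_. 0) \<in> pmod N e" by (simp add: pmod_def)
    from scale[OF this, of 0] show ?case by simp
  next
    case (Suc K)
    have "(\<lambda>j. a K * w K j) \<in> pmod N e" using pmod_sum[of "Suc 0" "\<lambda>_. w K" N e "\<lambda>_. a K"] Suc.prems by simp
    with Suc show ?case by (simp add: add pmod_sum scale)
  qed
  \<comment> \<open>Module elements must vanish from index \<open>N\<close> on, whereas the entries
    of \<open>e\<close> there are arbitrary.\<close>
  define re where "re i = (\<lambda>j. if j < N then e i j else 0)" for i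
  define rf where "rf i = (\<lambda>j. if j < M then f i j else 0)" for i
  have re: "re i \<in> pmod N e" if "i < N" for i
    using e that by (simp add: re_def pmod_def equiv_idem_def)
  have rf: "rf i \<in> pmod M f" if "i < M" for i
    using f that by (simp add: rf_def pmod_def equiv_idem_def)
  define u where "u i = \<phi> (re i)" for i
  define v where "v i = inv_into (pmod N e) \<phi> (rf i)" for i
  have u: "u i \<in> pmod M f" if "i < N" for i
    using bij re[OF that] by (simp add: u_def bij_betwE)
  have v: "v i \<in> pmod N e" and \<phi>v: "\<phi> (v i) = rf i" if "i < M" for i
    using bij rf[OF that] by (auto simp: v_def bij_betw_def inv_into_into f_inv_into_f)
  have expand: "w = (\<lambda>j. \<Sum>k<N. w k * re k j)" if "w \<in> pmod N e" for w
  proof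
    fix j show "w j = (\<Sum>k<N. w k * re k j)"
      using that by (cases "j < N") (auto simp: pmod_def re_def)
  qed
  have expand': "w = (\<lambda>j. \<Sum>k<M. w k * rf k j)" if "w \<in> pmod M f" for w
  proof
    fix j show "w j = (\<Sum>k<M. w k * rf k j)"
      using that by (cases "j < M") (auto simp: pmod_def rf_def)
  qed
  have \<phi>: "\<phi> w j = (\<Sum>k<N. w k * u k j)" if "w \<in> pmod N e" for w j
    using fun_cong[OF lin[of N re w], of j] re expand[OF that] by (simp add: u_def)
  have inj: "w = w'" if "w \<in> pmod N e" "w' \<in> pmod N e" "\<phi> w = \<phi> w'" for w w'
    using bij that by (auto simp: bij_betw_def dest: inj_onD)
  show thesis
  proof (rule that[of u v])
    show "eqv N \<sigma> M \<tau> u"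
      unfolding eqv_def
    proof (intro allI impI)
      fix L h i m assume L: "clin ofA L" and im: "i < N" "m < M"
      \<comment> \<open>The action of h on a row of e is a combination of rows with scalar
        coefficients; \<phi> carries this relation over to the rows of u.\<close>
      have "uact cop ofA act N \<sigma> h (re i) = (\<lambda>j. \<Sum>k<N. ofA (\<sigma> h k i) * re k j)"
      proof
        fix j show "uact cop ofA act N \<sigma> h (re i) j = (\<Sum>k<N. ofA (\<sigma> h k i) * re k j)"
          using equiv_idem_uact[OF e im(1), of j "re i" h]
          by (cases "j < N") (auto simp: re_def uact_def)
      qed
      then have "uact cop ofA act M \<tau> h (u i) = (\<lambda>j. \<Sum>k<N. ofA (\<sigma> h k i) * u k j)"
        using equi[OF re[OF im(1)], of h] lin[of N re] re by (simp add: u_def)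
      then have "L (uact cop ofA act M \<tau> h (u i) m) = (\<Sum>k<N. \<sigma> h k i * L (u k m))"
        using L by (simp add: clin_sum[OF L]) (simp add: clin_def)
      then show "tev (\<lambda>ys. \<Sum>j<M. \<tau> (ys ! 1) m j * L (act (ys ! 0) (u i j))) (cop h)
        = (\<Sum>k<N. \<sigma> h k i * L (u k m))"
        by (simp only: clin_uact[OF L im(2)])
    qed
  next
    fix i j assume ij: "i < N" "j < N"
    \<comment> \<open>After applying \<phi>, the left side is u_i f = u_i, which is the image of the
      row of e; injectivity does the rest.\<close>
    have "(\<lambda>j. \<Sum>k<M. u i k * v k j) = re i"
    proof (rule inj)
      show "(\<lambda>j. \<Sum>k<M. u i k * v k j) \<in> pmod N e" by (intro pmod_sum v)
      have "\<phi> (\<lambda>j. \<Sum>k<M. u i k * v k j) = (\<lambda>j. \<Sum>k<M. u i k * rf k j)"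
        using lin[of M v "u i"] v \<phi>v by simp
      then show "\<phi> (\<lambda>j. \<Sum>k<M. u i k * v k j) = \<phi> (re i)"
        using expand'[OF u[OF ij(1)]] by (simp add: u_def[symmetric])
    qed (rule re[OF ij(1)])
    then show "(\<Sum>k<M. u i k * v k j) = e i j" using ij by (simp add: re_def fun_eq_iff)
  next
    fix i j assume "i < M" "j < M"
    then show "(\<Sum>k<N. v i k * u k j) = f i j"
      using \<phi>[OF v, of i j] \<phi>v by (simp add: rf_def)
  next
    fix i j assume "i < M" "j < N"
    then show "(\<Sum>k<N. v i k * e k j) = v i j" using v[of i] by (simp add: pmod_def)
  next
    fix i j assume ij: "i < M" "j < N"
    have "(\<lambda>j. \<Sum>k<M. rf i k * v k j) = v i"
    proof (rule inj)
      show "(\<lambda>j. \<Sum>k<M. rf i k * v k j) \<in> pmod N e" by (intro pmod_sum v)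
      have "\<phi> (\<lambda>j. \<Sum>k<M. rf i k * v k j) = (\<lambda>j. \<Sum>k<M. rf i k * rf k j)"
        using lin[of M v "rf i"] v \<phi>v by simp
      then show "\<phi> (\<lambda>j. \<Sum>k<M. rf i k * v k j) = \<phi> (v i)"
        using expand'[OF rf[OF ij(1)]] \<phi>v[OF ij(1)] by simp
    qed (rule v[OF ij(1)])
    then show "(\<Sum>k<M. f i k * v k j) = v i j" using ij by (simp add: rf_def fun_eq_iff)
  next
    fix i j assume "i < N" "j < M"
    then show "(\<Sum>k<N. e i k * u k j) = u i j"
      using \<phi>[OF re, of i j] by (simp add: u_def[symmetric]) (simp add: re_def)
  next
    fix i j assume "i < N" "j < M"
    then show "(\<Sum>k<M. u i k * f k j) = u i j" using u[of i] by (simp add: pmod_def)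
  qed
qed

lemma cyc_homologous_chern_iso:
  assumes e: "equiv_idem ofU cop ofA act N e \<sigma>" and f: "equiv_idem ofU cop ofA act M f \<tau>"
    and iso: "mod_iso cop ofA act N e \<sigma> M f \<tau>"
  shows "cyc_homologous ofU cop ofA act n (chern n N e \<sigma>) (chern n M f \<tau>)"
  unfolding cyc_homologous_iff_null
proof (cases "even n")
  case True
  have idem: "\<And>i j. i < N \<Longrightarrow> j < N \<Longrightarrow> (\<Sum>k<N. e i k * e k j) = e i j"
    "\<And>i j. i < M \<Longrightarrow> j < M \<Longrightarrow> (\<Sum>k<M. f i k * f k j) = f i j"
    using e f by (simp_all add: equiv_idem_def)
  show "null n (csub (chern n N e \<sigma>) (chern n M f \<tau>))"
  proof (rule isomorphism_matrices[OF e f iso], goal_cases)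
    case (1 u v)
    show ?case
      by (rule null_isomorphic[OF True rep_equiv_idem[OF e] rep_equiv_idem[OF f]
            eqv_equiv_idem[OF e] eqv_equiv_idem[OF f] 1(1) idem 1(2-7)])
  qed
next
  \<comment> \<open>In odd degree each of the two characters vanishes modulo 1 - \<lambda> on its
    own.\<close>
  case False
  then show "null n (csub (chern n N e \<sigma>) (chern n M f \<tau>))"
    by (intro null_diff null_in_im_lam in_im_lam_chern e f)
qed

text \<open>Additivity holds already for the chains themselves, so the difference is the zero
  chain.\<close>

lemma cyc_homologous_chern_bdiag:
  "cyc_homologous ofU cop ofA act n
      (chern n (N + M) (bdiag N e f) (\<lambda>h. bdiag N (\<sigma> h) (\<tau> h)))
      (cadd (chern n N e \<sigma>) (chern n M f \<tau>))"
  unfolding cyc_homologous_iff_null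
proof (rule null_cong[OF null_zero], unfold ceq_iff, intro allI impI)
  fix h :: 'u and \<phi> :: "'a list \<Rightarrow> complex" assume \<phi>: "multilin ofA (Suc n) \<phi>"
  show "tev \<phi> (csub (chern n (N + M) (bdiag N e f) (\<lambda>h. bdiag N (\<sigma> h) (\<tau> h)))
      (cadd (chern n N e \<sigma>) (chern n M f \<tau>)) h) = tev \<phi> []"
    using tev_Tr_blk[OF \<phi>, of "\<lambda>_ _. 0" "\<lambda>_ _. 0" N M \<sigma> \<tau> e f h]
    by (simp add: csub_def cadd_def chern_def bdiag_eq_blk[of N e f] del: replicate.simps)
qed

end

theorem theorem7p2:
  fixes ofU :: "complex \<Rightarrow> 'u::ring_1" and cop :: "'u \<Rightarrow> 'u ten"
    and eps :: "'u \<Rightarrow> complex" and S :: "'u \<Rightarrow> 'u"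
    and ofA :: "complex \<Rightarrow> 'a::ring_1" and act :: "'u \<Rightarrow> 'a \<Rightarrow> 'a"
  assumes "hopf_algebra ofU cop eps S"
    and "module_algebra ofU cop eps ofA act"
  shows
    "(\<forall>n N e \<sigma>. equiv_idem ofU cop ofA act N e \<sigma> \<longrightarrow>
        chain ofU cop ofA act n (chern n N e \<sigma>) \<and>
        cyc_cycle ofU cop ofA act n (chern n N e \<sigma>))
   \<and> (\<forall>n N e \<sigma> M f \<tau>.
        equiv_idem ofU cop ofA act N e \<sigma> \<and> equiv_idem ofU cop ofA act M f \<tau> \<and>
        mod_iso cop ofA act N e \<sigma> M f \<tau> \<longrightarrow>
        cyc_homologous ofU cop ofA act n (chern n N e \<sigma>) (chern n M f \<tau>))
   \<and> (\<forall>n N e \<sigma> M f \<tau>.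
        equiv_idem ofU cop ofA act N e \<sigma> \<and> equiv_idem ofU cop ofA act M f \<tau> \<longrightarrow>
        cyc_homologous ofU cop ofA act n
          (chern n (N + M) (bdiag N e f) (\<lambda>h. bdiag N (\<sigma> h) (\<tau> h)))
          (cadd (chern n N e \<sigma>) (chern n M f \<tau>)))"
proof -
  interpret hopf_module_algebra ofU cop eps S ofA act
    by unfold_locales fact+
  show ?thesis
    by (intro conjI allI impI; (elim conjE)?;
        rule chain_chern cyc_cycle_chern cyc_homologous_chern_iso cyc_homologous_chern_bdiag; assumption)
qed

end
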